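(* Let $K$ be a non-perfect, separably closed field of characteristic $3$. There is no curve in $\mathcal{C}_i$ which is $\mathbb{P}^2_K$-equivalent to a curve in $\mathcal{C}_j$ for $i\neq j$. Moreover: (1) If $C,C'\in\mathcal{C}_0$ are $\mathbb{P}^2_K$-equivalent and $C$ is defined by $(x^2-yz)^2+(Ax+By+Gz)^3x$ with $A,B,G\in K^{1/3}$, then $C'$ is defined by one of the equations $$(x^2-yz)^2+(Ax+\beta\lambda By+\beta\lambda^{-1}Gz)^3x\quad\text{or}\quad(x^2-yz)^2+(Ax+\lambda\beta Gy+\lambda^{-1}\beta Bz)^3x$$ where $\lambda\in K\setminus\{0\}$ and $\beta\in\{1,-1\}$. The automorphism $T$ of $\mathbb{P}^2_K$ relating $C$ to $C'$ is defined by $T(x:y:z)=(\beta x:\lambda y:\lambda^{-1}z)$ or $T(x:y:z)=(\beta x:\lambda^{-1}z:\lambda y)$, respectively. (2) If $C,C'\in\mathcal{C}_1$ are $\mathbb{P}^2_K$-equivalent and $C$ is defined by $(x^2-yz)^2+(Ax+By+Gz)^3z$ with $A,B,G\in K^{1/3}$, then $C'$ is defined by the equation $$(x^2-yz)^2+\left(\Big(\frac{\beta A+B\lambda_1}{\lambda_2^{1/3}}\Big)x+\lambda_2^{2/3}By+\Big(\frac{B\lambda_1^2-\beta A\lambda_1+G}{\lambda_2^{4/3}}\Big)z\right)^3z$$ where $\lambda_1\in K$, $\lambda_2\in K\setminus\{0\}$ and $\beta\in\{1,-1\}$. The automorphism $T$ of $\mathbb{P}^2_K$ relating $C$ to $C'$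 is defined by $T(x:y:z)=(\beta x-\beta(\lambda_1/\lambda_2)z:\lambda_1x+\lambda_2y+(\lambda_1^2/\lambda_2)z:\lambda_2^{-1}z)$. (3) If $C,C'\in\mathcal{C}_2$ are $\mathbb{P}^2_K$-equivalent and $C$ is defined by $(xy)^2+(Ax+By+Gz)^3z$ with $A,B,G\in K^{1/3}$, then $C'$ is defined by one of the equations $$(xy)^2+(\lambda_2^{1/3}\lambda_1Ax+\lambda_2^{1/3}\lambda_1^{-1}By+\lambda_2^{4/3}Gz)^3z\quad\text{or}\quad(xy)^2+(\lambda_2^{1/3}\lambda_1Ay+\lambda_2^{1/3}\lambda_1^{-1}Bx+\lambda_2^{4/3}Gz)^3z$$ where $\lambda_1,\lambda_2\in K\setminus\{0\}$. The automorphism $T$ of $\mathbb{P}^2_K$ relating $C$ to $C'$ is defined by $T(x:y:z)=(\lambda_1x:\lambda_1^{-1}y:\lambda_2z)$ or $T(x:y:z)=(\lambda_1y:\lambda_1^{-1}x:\lambda_2z)$, respectively. Here "$T$ relates $C$ to $C'$" means that the equation of $C'$ is obtained, up to a nonzero scalar, by substituting $T$ into the equation of $C$ (i.e. $C'=T^{-1}(C)$); in each case every such $T$ has one of the listed forms for some values of the parameters.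
   Context: Two curves in $\mathbb{P}^2_K$ are $\mathbb{P}^2_K$-equivalent if an automorphism of $\mathbb{P}^2_K$ maps one onto the other. Fix a basis $x,y,z$ of $H^0(\mathbb{P}^2_K,\mathcal{O}(1))$. The families of quartic curves in $\mathbb{P}^2_K$ are: $\mathcal{C}_0$: $a(x^2-yz)^2+\big((t_1^2-t_2^2)x+(t_2-t_1)y+(t_1t_2^2-t_2t_1^2)z\big)^3x=0$, where $t_1\neq t_2\in K^{1/3}\setminus K$ and $a\in K\setminus\{0,-(t_1^2-t_2^2)^3\}$. $\mathcal{C}_1$: $a(x^2-yz)^2+\big((t_1^2-t_2^2)x+(t_2-t_1)y+(t_1t_2^2-t_2t_1^2)z\big)^3z=0$, where $t_1\neq t_2\in K^{1/3}\setminus K$ and $a\in K\setminus\{0\}$. $\mathcal{C}_2$: $a(xy)^2+(t_1x+t_2y-t_1t_2z)^3z=0$, where $t_1\neq t_2\in K^{1/3}\setminus K$ and $a\in K\setminus\{0\}$. Dividing by $a$ (and absorbing $a^{1/3}\in K^{1/3}$ in the linear form), every such curve has an equation in which the coefficient of $(x^2-yz)^2$, respectively $(xy)^2$, is $1$ and the linear form has coefficients $A,B,G\in K^{1/3}$. *)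

theory Defs
  imports
    "HOL-Analysis.Cartesian_Space"
    "HOL-Computational_Algebra.Polynomial"
    "HOL-Algebra.Algebraic_Closure_Type"
    "HOL-Library.Poly_Mapping"
    "HOL-Library.Numeral_Type"
begin

section \<open>Fields\<close>

definition separable_poly :: "'k::field poly \<Rightarrow> bool" where
  "separable_poly p \<longleftrightarrow> coprime p (pderiv p)"

definition perfect_field :: "'k::field itself \<Rightarrow> bool" where
  "perfect_field _ \<longleftrightarrow> (\<forall>p::'k poly. irreducible p \<longrightarrow> separable_poly p)"

definition separably_closed_field :: "'k::field itself \<Rightarrow> bool" where
  "separably_closed_field _ \<longleftrightarrow>
     (\<forall>p::'k poly. irreducible p \<longrightarrow> separable_poly p \<longrightarrow> degree p = 1)"

text \<open>
  The field \<open>K\<close> is the type \<open>'k\<close>. It is embedded by \<^const>\<open>to_ac\<close> into the algebraic closure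
  \<open>'k alg_closure\<close>, and \<open>K\<close> and \<open>K\<^sup>1\<^sup>/\<^sup>3\<close> are regarded as subsets of this closure.
\<close>

definition base_field :: "'k::field alg_closure set" where
  "base_field = range to_ac"

definition cube_root_field :: "'k::field alg_closure set" where
  "cube_root_field = {t. t ^ 3 \<in> base_field}"

text \<open>In characteristic 3 every element of \<open>K\<close> has exactly one cube root in the closure.\<close>

definition cbrt :: "'k::field \<Rightarrow> 'k alg_closure" where
  "cbrt c = (THE r. r ^ 3 = to_ac c)"


section \<open>Polynomials in three variables and plane curves\<close>

text \<open>
  A polynomial is a finitely supported map from exponent vectors to coefficients. The
  coordinates \<open>x, y, z\<close> are the variables with index 1, 2, 3 of the three-element type \<open>3\<close>.
\<close>

type_synonym 'k mpoly3 = "(3 \<Rightarrow>\<^sub>0 nat) \<Rightarrow>\<^sub>0 'k"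

definition mconst :: "'k::comm_ring_1 \<Rightarrow> 'k mpoly3" where
  "mconst c = Poly_Mapping.single 0 c"

definition mvar :: "3 \<Rightarrow> 'k::comm_ring_1 mpoly3" where
  "mvar i = Poly_Mapping.single (Poly_Mapping.single i 1) 1"

abbreviation var_x :: "'k::comm_ring_1 mpoly3" where "var_x \<equiv> mvar 1"
abbreviation var_y :: "'k::comm_ring_1 mpoly3" where "var_y \<equiv> mvar 2"
abbreviation var_z :: "'k::comm_ring_1 mpoly3" where "var_z \<equiv> mvar 3"

definition linear_form :: "'k::comm_ring_1 \<Rightarrow> 'k \<Rightarrow> 'k \<Rightarrow> 'k mpoly3" where
  "linear_form A B G = mconst A * var_x + mconst B * var_y + mconst G * var_z"

definition homogeneous :: "nat \<Rightarrow> 'k::comm_ring_1 mpoly3 \<Rightarrow> bool" where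
  "homogeneous d F \<longleftrightarrow>
     (\<forall>m \<in> Poly_Mapping.keys F. (\<Sum>i\<in>UNIV. Poly_Mapping.lookup m i) = d)"

text \<open>
  A curve in the projective plane over \<open>K\<close> is given by a nonzero form over \<open>K\<close>, and two forms
  give the same curve (as a closed subscheme) iff they differ by a nonzero scalar. The curve is
  represented by the class of all its equations.
\<close>

definition curve_of :: "'k::field mpoly3 \<Rightarrow> 'k mpoly3 set" where
  "curve_of F = {mconst c * F | c. c \<noteq> 0}"

definition plane_curves :: "nat \<Rightarrow> 'k::field mpoly3 set set" where
  "plane_curves d = {curve_of F | F. F \<noteq> 0 \<and> homogeneous d F}"

text \<open>
  \<open>E\<close> is a polynomial over the closure whose coefficients lie in \<open>K\<close> and which, read over \<open>K\<close>,
  is an equation of \<open>C\<close>. Cubes of linear forms over \<open>K\<^sup>1\<^sup>/\<^sup>3\<close> have coefficients in \<open>K\<close>.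
\<close>

definition has_equation :: "'k::field mpoly3 set \<Rightarrow> 'k alg_closure mpoly3 \<Rightarrow> bool" where
  "has_equation C E \<longleftrightarrow> (\<exists>F\<in>C. Poly_Mapping.map to_ac F = E)"


section \<open>Automorphisms of the projective plane\<close>

text \<open>
  An automorphism is an invertible matrix up to nonzero scalars; row \<open>i\<close> of the matrix gives the
  \<open>i\<close>-th coordinate of \<open>T(x:y:z)\<close> as a linear form in \<open>x, y, z\<close>.
\<close>

definition projectivity :: "'k::field^3^3 \<Rightarrow> ('k^3^3) set" where
  "projectivity M = {\<chi> i j. c * M $ i $ j | c. c \<noteq> 0}"

definition plane_automorphisms :: "('k::field^3^3) set set" where
  "plane_automorphisms = {projectivity M | M. invertible M}"

definition linear_subst :: "'k::comm_ring_1^3^3 \<Rightarrow> 'k mpoly3 \<Rightarrow> 'k mpoly3" where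
  "linear_subst M F =
     (\<Sum>m \<in> Poly_Mapping.keys F. mconst (Poly_Mapping.lookup F m) *
        (\<Prod>i\<in>UNIV. (\<Sum>j\<in>UNIV. mconst (M $ i $ j) * mvar j) ^ Poly_Mapping.lookup m i))"

text \<open>The inverse image of \<open>C\<close> under \<open>T\<close>: substitute \<open>T\<close> into the equations of \<open>C\<close>.\<close>

definition curve_pullback :: "('k::field^3^3) set \<Rightarrow> 'k mpoly3 set \<Rightarrow> 'k mpoly3 set" where
  "curve_pullback T C = {linear_subst M F | M F. M \<in> T \<and> F \<in> C}"

definition relates :: "('k::field^3^3) set \<Rightarrow> 'k mpoly3 set \<Rightarrow> 'k mpoly3 set \<Rightarrow> bool" where
  "relates T C C' \<longleftrightarrow> T \<in> plane_automorphisms \<and> C' = curve_pullback T C"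

definition plane_equivalent :: "'k::field mpoly3 set \<Rightarrow> 'k mpoly3 set \<Rightarrow> bool" where
  "plane_equivalent C C' \<longleftrightarrow> (\<exists>T. relates T C C')"


section \<open>The three families of quartics\<close>

definition family0 :: "'k::field mpoly3 set set" where
  "family0 = {C \<in> plane_curves 4. \<exists>t1 t2 a.
     t1 \<noteq> t2 \<and> t1 \<in> cube_root_field - base_field \<and> t2 \<in> cube_root_field - base_field \<and>
     a \<noteq> 0 \<and> to_ac a \<noteq> - ((t1^2 - t2^2)^3) \<and>
     has_equation C
       (mconst (to_ac a) * (var_x^2 - var_y * var_z)^2
        + (linear_form (t1^2 - t2^2) (t2 - t1) (t1 * t2^2 - t2 * t1^2))^3 * var_x)}"

definition family1 :: "'k::field mpoly3 set set" where
  "family1 = {C \<in> plane_curves 4. \<exists>t1 t2 a.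
     t1 \<noteq> t2 \<and> t1 \<in> cube_root_field - base_field \<and> t2 \<in> cube_root_field - base_field \<and>
     a \<noteq> 0 \<and>
     has_equation C
       (mconst (to_ac a) * (var_x^2 - var_y * var_z)^2
        + (linear_form (t1^2 - t2^2) (t2 - t1) (t1 * t2^2 - t2 * t1^2))^3 * var_z)}"

definition family2 :: "'k::field mpoly3 set set" where
  "family2 = {C \<in> plane_curves 4. \<exists>t1 t2 a.
     t1 \<noteq> t2 \<and> t1 \<in> cube_root_field - base_field \<and> t2 \<in> cube_root_field - base_field \<and>
     a \<noteq> 0 \<and>
     has_equation C
       (mconst (to_ac a) * (var_x * var_y)^2
        + (linear_form t1 t2 (- (t1 * t2)))^3 * var_z)}"

end

(*
  In characteristic 3 the cube of a linear form has the shape p1 x^3 + p2 y^3 + p3 z^3, so every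
  curve in question is k Q^2 + (p1 x^3 + p2 y^3 + p3 z^3) L with Q a quadratic and L a linear form.
  The monomials x^2 y^2, x^2 z^2, y^2 z^2, x^2 y z, x y^2 z, x y z^2 only occur in k Q^2. Comparing
  their coefficients shows that an automorphism carrying one such curve to another carries Q to a
  multiple of x^2 - y z if that is the target conic, and to a form in x and y only if the target is
  x y; the remaining coefficients then settle the latter case and show that L is carried to a
  multiple of the target line. An automorphism preserving the conic (or the pair of lines) and the
  line is of one of the listed forms after rescaling.
*)

theory Submission
  imports Defs
begin

section \<open>Substitution and extension of scalars\<close>

text \<open>In characteristic 3, where \<open>2 = -1\<close>, the six coefficients of
  \<open>k Q^2\<close> at monomials divisible by no cube of a variable are \<open>-k\<close> times
  the entries of the adjugate of the Gram matrix of \<open>Q\<close>. For the conic this adjugate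
  has rank 3 and determines \<open>Q\<close> up to a scalar. For \<open>x y\<close> it has rank 1
  and records only the kernel of the Gram matrix, that is, the absence of \<open>z\<close> in
  \<open>Q\<close>; hence the line pair also needs coefficients to which the cubic part contributes.
  All comparisons take place over \<open>K\<close>: a linear form over the cube root field enters
  through its cube, whose coefficients lie in \<open>K\<close>, and cube roots return only when the
  transformed equations are written down. An automorphism preserving the conic and one of the two
  lines multiplies \<open>x^2 - y z\<close> by the square of its entry \<open>m11\<close>, so
  division by \<open>m11\<close> makes it preserve the form exactly. For the line pair the factor is
  an arbitrary nonzero element of \<open>K\<close>; its square root exists because \<open>K\<close>
  is separably closed.\<close>

lemma poly_mapping_single_induct [case_names zero single_add]:
  assumes "P 0"
    and "\<And>m c F. P F \<Longrightarrow> P (Poly_Mapping.single m c + F)"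
  shows "P (F :: 'a \<Rightarrow>\<^sub>0 'b::comm_monoid_add)"
proof (induction F rule: Poly_Mapping.update_induct)
  case const
  show ?case by (fact assms(1))
next
  case (update F m c)
  have "Poly_Mapping.update m c F = Poly_Mapping.single m c + F"
    using update(1)
    by (intro poly_mapping_eqI)
       (auto simp: lookup_update lookup_add lookup_single when_def in_keys_iff)
  then show ?case using assms(2) update(3) by simp
qed

text \<open>Extension of scalars and linear substitution are both additive, and multiplicative on
  monomials by inspection. This shared bilinearity argument makes them multiplicative in general, so
  quartics can be transformed factor by factor instead of in expanded form.\<close>

lemma mult_hom_if_mult_on_singles:
  fixes \<phi> :: "('a::comm_monoid_add \<Rightarrow>\<^sub>0 'b::comm_ring_1) \<Rightarrow> 'c::comm_ring_1"
  assumes add: "\<And>F G. \<phi> (F + G) = \<phi> F + \<phi> G"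
    and single: "\<And>m n a b. \<phi> (Poly_Mapping.single (m + n) (a * b)) =
                   \<phi> (Poly_Mapping.single m a) * \<phi> (Poly_Mapping.single n b)"
  shows "\<phi> (F * G) = \<phi> F * \<phi> G"
proof -
  have zero: "\<phi> 0 = 0" using add[of 0 0] by simp
  have "\<phi> (Poly_Mapping.single m a * G) = \<phi> (Poly_Mapping.single m a) * \<phi> G" for m a
    by (induction G rule: poly_mapping_single_induct)
       (simp_all add: zero add single mult_single algebra_simps)
  then show ?thesis
    by (induction F rule: poly_mapping_single_induct) (simp_all add: zero add algebra_simps)
qed

lemma lookup_map_to_ac:
  "Poly_Mapping.lookup (Poly_Mapping.map to_ac F) m = to_ac (Poly_Mapping.lookup F m)"
  by (simp add: Poly_Mapping.map.rep_eq when_def)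

lemma map_to_ac_add:
  "Poly_Mapping.map to_ac (F + G) = Poly_Mapping.map to_ac F + Poly_Mapping.map to_ac G"
  by (intro poly_mapping_eqI) (simp add: lookup_map_to_ac lookup_add)

lemma map_to_ac_mult:
  "Poly_Mapping.map to_ac (F * G :: 'a::field mpoly3) =
   Poly_Mapping.map to_ac F * Poly_Mapping.map to_ac G"
  by (rule mult_hom_if_mult_on_singles) (simp_all add: map_to_ac_add mult_single)

lemma map_to_ac_eq_iff:
  "Poly_Mapping.map to_ac F = Poly_Mapping.map to_ac G \<longleftrightarrow> F = G"
  by (simp add: poly_mapping_eq_iff fun_eq_iff lookup_map_to_ac)

lemma map_to_ac_mconst: "Poly_Mapping.map to_ac (mconst c) = mconst (to_ac c)"
  by (simp add: mconst_def)

lemma map_to_ac_mvar: "Poly_Mapping.map to_ac (mvar i) = mvar i"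
  by (simp add: mvar_def)

lemma map_to_ac_power:
  "Poly_Mapping.map to_ac (F ^ n :: 'a::field mpoly3) = Poly_Mapping.map to_ac F ^ n"
  by (induction n) (simp_all add: map_to_ac_mult map_to_ac_mconst[of 1, unfolded mconst_def, simplified])

lemma mconst_add: "mconst (a + b) = mconst a + mconst b"
  by (simp add: mconst_def single_add)

lemma mconst_mult: "mconst (a * b) = mconst a * mconst b"
  by (simp add: mconst_def mult_single)

lemma mconst_power: "mconst (a ^ n) = mconst a ^ n"
  by (induction n) (simp_all add: mconst_mult, simp add: mconst_def)

lemma linear_subst_single:
  "linear_subst M (Poly_Mapping.single m c) =
   mconst c * (\<Prod>i\<in>UNIV. (\<Sum>j\<in>UNIV. mconst (M $ i $ j) * mvar j) ^ Poly_Mapping.lookup m i)"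
  by (simp add: linear_subst_def mconst_def)

lemma linear_subst_add: "linear_subst M (F + G) = linear_subst M F + linear_subst M G"
  unfolding linear_subst_def
  by (rule setsum_keys_plus_distrib) (simp_all add: mconst_add mconst_def[of 0] algebra_simps)

lemma linear_subst_mult: "linear_subst M (F * G) = linear_subst M F * linear_subst M G"
  by (rule mult_hom_if_mult_on_singles)
     (simp_all add: linear_subst_add linear_subst_single lookup_add power_add prod.distrib
        mconst_mult mult_ac)

lemma linear_subst_mconst: "linear_subst M (mconst c) = mconst c"
  by (simp add: mconst_def linear_subst_single)

lemma linear_subst_power: "linear_subst M (F ^ n) = linear_subst M F ^ n"
  by (induction n) (simp_all add: linear_subst_mult linear_subst_mconst[of _ 1, unfolded mconst_def, simplified])

lemma linear_subst_mvar:
  "linear_subst M (mvar i) = linear_form (M $ i $ 1) (M $ i $ 2) (M $ i $ 3)"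
proof -
  have "linear_subst M (mvar i) = (\<Prod>k\<in>UNIV. (\<Sum>j\<in>UNIV. mconst (M $ k $ j) * mvar j) ^ (if k = i then 1 else 0))"
    by (simp add: mvar_def linear_subst_single lookup_single when_def eq_commute[of i] mconst_def[of 1]
          cong: if_cong)
  also have "\<dots> = (\<Prod>k\<in>UNIV. if k = i then \<Sum>j\<in>UNIV. mconst (M $ k $ j) * mvar j else 1)"
    by (intro prod.cong) auto
  also have "\<dots> = (\<Sum>j\<in>UNIV. mconst (M $ i $ j) * mvar j)"
    by simp
  finally show ?thesis by (simp add: linear_form_def sum_3)
qed

section \<open>Quartics of the form \<open>k Q^2 + P L\<close> and their coefficients\<close>

text \<open>Exponent vectors as explicit triples: addition and equality become arithmetic on
  numerals, which lets coefficients of expanded products be read off by simplification.\<close>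

definition monomial_exponent :: "nat \<Rightarrow> nat \<Rightarrow> nat \<Rightarrow> 3 \<Rightarrow>\<^sub>0 nat" where
  "monomial_exponent i j k =
     Poly_Mapping.single 1 i + Poly_Mapping.single 2 j + Poly_Mapping.single 3 k"

lemma monomial_exponent_eq_iff:
  "monomial_exponent i j k = monomial_exponent i' j' k' \<longleftrightarrow> i = i' \<and> j = j' \<and> k = k'"
  by (auto simp: poly_mapping_eq_iff fun_eq_iff forall_3 monomial_exponent_def lookup_add
        lookup_single when_def)

lemma monomial_exponent_add:
  "monomial_exponent i j k + monomial_exponent i' j' k' =
   monomial_exponent (i + i') (j + j') (k + k')"
  by (simp add: monomial_exponent_def single_add add_ac)

definition quadratic_form :: "'k::comm_ring_1 \<Rightarrow> 'k \<Rightarrow> 'k \<Rightarrow> 'k \<Rightarrow> 'k \<Rightarrow> 'k \<Rightarrow> 'k mpoly3" where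
  "quadratic_form a b c d e f =
     mconst a * var_x ^ 2 + mconst b * var_y ^ 2 + mconst c * var_z ^ 2
     + mconst d * (var_x * var_y) + mconst e * (var_x * var_z) + mconst f * (var_y * var_z)"

text \<open>In characteristic 3 this is the cube of a linear form, parametrised by the cubes of its
  coefficients; these lie in \<open>K\<close> even if the coefficients lie only in
  \<open>cube_root_field\<close>.\<close>

definition diagonal_cubic :: "'k::comm_ring_1 \<Rightarrow> 'k \<Rightarrow> 'k \<Rightarrow> 'k mpoly3" where
  "diagonal_cubic a b c = mconst a * var_x ^ 3 + mconst b * var_y ^ 3 + mconst c * var_z ^ 3"

lemma variables_eq_single:
  "var_x = Poly_Mapping.single (monomial_exponent 1 0 0) 1"
  "var_y = Poly_Mapping.single (monomial_exponent 0 1 0) 1"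
  "var_z = Poly_Mapping.single (monomial_exponent 0 0 1) 1"
  "mconst c = Poly_Mapping.single (monomial_exponent 0 0 0) c"
  by (simp_all add: mvar_def mconst_def monomial_exponent_def)

text \<open>Common shape of the three families. The factors stay separate arguments so that a
  substitution acts on each of them; a given form may a priori have several such presentations,
  which is what the coefficient comparison has to control.\<close>

fun quartic :: "'k::comm_ring_1 \<Rightarrow> 'k \<times> 'k \<times> 'k \<times> 'k \<times> 'k \<times> 'k \<Rightarrow>
    'k \<times> 'k \<times> 'k \<Rightarrow> 'k \<times> 'k \<times> 'k \<Rightarrow> 'k mpoly3" where
  "quartic k (a, b, c, d, e, f) (p1, p2, p3) (l1, l2, l3) =
     mconst k * (quadratic_form a b c d e f) ^ 2 + diagonal_cubic p1 p2 p3 * linear_form l1 l2 l3"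

text \<open>The first nine monomials are divisible by the cube of a variable and involve the product
  \<open>P L\<close>; the last six come from \<open>k Q^2\<close> alone.\<close>

lemma lookup_quartic:
  fixes k a b c d e f p1 p2 p3 l1 l2 l3 :: "'k::comm_ring_1"
  defines "F \<equiv> quartic k (a, b, c, d, e, f) (p1, p2, p3) (l1, l2, l3)"
  shows "Poly_Mapping.lookup F (monomial_exponent 4 0 0) = k * a ^ 2 + p1 * l1"
    "Poly_Mapping.lookup F (monomial_exponent 3 1 0) = 2 * k * a * d + p1 * l2"
    "Poly_Mapping.lookup F (monomial_exponent 3 0 1) = 2 * k * a * e + p1 * l3"
    "Poly_Mapping.lookup F (monomial_exponent 1 3 0) = 2 * k * b * d + p2 * l1"
    "Poly_Mapping.lookup F (monomial_exponent 0 4 0) = k * b ^ 2 + p2 * l2"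
    "Poly_Mapping.lookup F (monomial_exponent 0 3 1) = 2 * k * b * f + p2 * l3"
    "Poly_Mapping.lookup F (monomial_exponent 1 0 3) = 2 * k * c * e + p3 * l1"
    "Poly_Mapping.lookup F (monomial_exponent 0 1 3) = 2 * k * c * f + p3 * l2"
    "Poly_Mapping.lookup F (monomial_exponent 0 0 4) = k * c ^ 2 + p3 * l3"
    "Poly_Mapping.lookup F (monomial_exponent 2 2 0) = k * (d ^ 2 + 2 * a * b)"
    "Poly_Mapping.lookup F (monomial_exponent 2 0 2) = k * (e ^ 2 + 2 * a * c)"
    "Poly_Mapping.lookup F (monomial_exponent 0 2 2) = k * (f ^ 2 + 2 * b * c)"
    "Poly_Mapping.lookup F (monomial_exponent 2 1 1) = 2 * k * (a * f + d * e)"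
    "Poly_Mapping.lookup F (monomial_exponent 1 2 1) = 2 * k * (b * e + d * f)"
    "Poly_Mapping.lookup F (monomial_exponent 1 1 2) = 2 * k * (c * d + e * f)"
proof -
  have F: "F = mconst k * (quadratic_form a b c d e f * quadratic_form a b c d e f)
             + diagonal_cubic p1 p2 p3 * linear_form l1 l2 l3"
    by (simp add: F_def power2_eq_square)
  note expand = F quadratic_form_def diagonal_cubic_def linear_form_def
        variables_eq_single power2_eq_square power3_eq_cube mult_single monomial_exponent_add
        distrib_left distrib_right lookup_add lookup_single monomial_exponent_eq_iff when_def
  show "Poly_Mapping.lookup F (monomial_exponent 4 0 0) = k * a ^ 2 + p1 * l1"
    "Poly_Mapping.lookup F (monomial_exponent 3 1 0) = 2 * k * a * d + p1 * l2"
    "Poly_Mapping.lookup F (monomial_exponent 3 0 1) = 2 * k * a * e + p1 * l3"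
    "Poly_Mapping.lookup F (monomial_exponent 1 3 0) = 2 * k * b * d + p2 * l1"
    "Poly_Mapping.lookup F (monomial_exponent 0 4 0) = k * b ^ 2 + p2 * l2"
    "Poly_Mapping.lookup F (monomial_exponent 0 3 1) = 2 * k * b * f + p2 * l3"
    "Poly_Mapping.lookup F (monomial_exponent 1 0 3) = 2 * k * c * e + p3 * l1"
    "Poly_Mapping.lookup F (monomial_exponent 0 1 3) = 2 * k * c * f + p3 * l2"
    "Poly_Mapping.lookup F (monomial_exponent 0 0 4) = k * c ^ 2 + p3 * l3"
    "Poly_Mapping.lookup F (monomial_exponent 2 2 0) = k * (d ^ 2 + 2 * a * b)"
    "Poly_Mapping.lookup F (monomial_exponent 2 0 2) = k * (e ^ 2 + 2 * a * c)"
    "Poly_Mapping.lookup F (monomial_exponent 0 2 2) = k * (f ^ 2 + 2 * b * c)"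
    "Poly_Mapping.lookup F (monomial_exponent 2 1 1) = 2 * k * (a * f + d * e)"
    "Poly_Mapping.lookup F (monomial_exponent 1 2 1) = 2 * k * (b * e + d * f)"
    "Poly_Mapping.lookup F (monomial_exponent 1 1 2) = 2 * k * (c * d + e * f)"
    by (simp add: expand; simp add: algebra_simps)+
qed

lemma quartic_eqD:
  fixes k k' :: "'k::comm_ring_1"
  assumes "quartic k (a, b, c, d, e, f) (p1, p2, p3) (l1, l2, l3) =
    quartic k' (a', b', c', d', e', f') (p1', p2', p3') (l1', l2', l3')"
  shows "k * a ^ 2 + p1 * l1 = k' * a' ^ 2 + p1' * l1'"
    "2 * k * a * d + p1 * l2 = 2 * k' * a' * d' + p1' * l2'"
    "2 * k * a * e + p1 * l3 = 2 * k' * a' * e' + p1' * l3'"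
    "2 * k * b * d + p2 * l1 = 2 * k' * b' * d' + p2' * l1'"
    "k * b ^ 2 + p2 * l2 = k' * b' ^ 2 + p2' * l2'"
    "2 * k * b * f + p2 * l3 = 2 * k' * b' * f' + p2' * l3'"
    "2 * k * c * e + p3 * l1 = 2 * k' * c' * e' + p3' * l1'"
    "2 * k * c * f + p3 * l2 = 2 * k' * c' * f' + p3' * l2'"
    "k * c ^ 2 + p3 * l3 = k' * c' ^ 2 + p3' * l3'"
    "k * (d ^ 2 + 2 * a * b) = k' * (d' ^ 2 + 2 * a' * b')"
    "k * (e ^ 2 + 2 * a * c) = k' * (e' ^ 2 + 2 * a' * c')"
    "k * (f ^ 2 + 2 * b * c) = k' * (f' ^ 2 + 2 * b' * c')"
    "2 * k * (a * f + d * e) = 2 * k' * (a' * f' + d' * e')"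
    "2 * k * (b * e + d * f) = 2 * k' * (b' * e' + d' * f')"
    "2 * k * (c * d + e * f) = 2 * k' * (c' * d' + e' * f')"
proof -
  have eq: "Poly_Mapping.lookup (quartic k (a, b, c, d, e, f) (p1, p2, p3) (l1, l2, l3)) m =
    Poly_Mapping.lookup (quartic k' (a', b', c', d', e', f') (p1', p2', p3') (l1', l2', l3')) m" for m
    by (simp only: assms)
  note coeff = eq[of "monomial_exponent i j n" for i j n]
  show "k * a ^ 2 + p1 * l1 = k' * a' ^ 2 + p1' * l1'"
    "2 * k * a * d + p1 * l2 = 2 * k' * a' * d' + p1' * l2'"
    "2 * k * a * e + p1 * l3 = 2 * k' * a' * e' + p1' * l3'"
    "2 * k * b * d + p2 * l1 = 2 * k' * b' * d' + p2' * l1'"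
    "k * b ^ 2 + p2 * l2 = k' * b' ^ 2 + p2' * l2'"
    "2 * k * b * f + p2 * l3 = 2 * k' * b' * f' + p2' * l3'"
    "2 * k * c * e + p3 * l1 = 2 * k' * c' * e' + p3' * l1'"
    "2 * k * c * f + p3 * l2 = 2 * k' * c' * f' + p3' * l2'"
    "k * c ^ 2 + p3 * l3 = k' * c' ^ 2 + p3' * l3'"
    "k * (d ^ 2 + 2 * a * b) = k' * (d' ^ 2 + 2 * a' * b')"
    "k * (e ^ 2 + 2 * a * c) = k' * (e' ^ 2 + 2 * a' * c')"
    "k * (f ^ 2 + 2 * b * c) = k' * (f' ^ 2 + 2 * b' * c')"
    "2 * k * (a * f + d * e) = 2 * k' * (a' * f' + d' * e')"
    "2 * k * (b * e + d * f) = 2 * k' * (b' * e' + d' * f')"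
    "2 * k * (c * d + e * f) = 2 * k' * (c' * d' + e' * f')"
    using coeff[of 4 0 0]
      coeff[of 3 1 0]
      coeff[of 3 0 1]
      coeff[of 1 3 0]
      coeff[of 0 4 0]
      coeff[of 0 3 1]
      coeff[of 1 0 3]
      coeff[of 0 1 3]
      coeff[of 0 0 4]
      coeff[of 2 2 0]
      coeff[of 2 0 2]
      coeff[of 0 2 2]
      coeff[of 2 1 1]
      coeff[of 1 2 1]
      coeff[of 1 1 2]
    unfolding lookup_quartic .
qed

lemma quartic_scale:
  "mconst c * quartic k q (p1, p2, p3) l = quartic (c * k) q (c * p1, c * p2, c * p3) l"
  by (cases q, cases l) (simp add: diagonal_cubic_def mconst_mult algebra_simps)

lemma map_to_ac_quartic:
  fixes k :: "'k::field"
  shows "Poly_Mapping.map to_ac (quartic k (a, b, c, d, e, f) (p1, p2, p3) (l1, l2, l3)) =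
     quartic (to_ac k) (to_ac a, to_ac b, to_ac c, to_ac d, to_ac e, to_ac f)
       (to_ac p1, to_ac p2, to_ac p3) (to_ac l1, to_ac l2, to_ac l3)"
  by (simp add: quadratic_form_def diagonal_cubic_def linear_form_def map_to_ac_add map_to_ac_mult
      map_to_ac_power map_to_ac_mconst map_to_ac_mvar)

section \<open>Cubes in characteristic 3\<close>

lemma cube_add_char3:
  fixes x y :: "'a::comm_ring_1"
  assumes "(3::'a) = 0"
  shows "(x + y) ^ 3 = x ^ 3 + y ^ 3"
proof -
  have "(x + y) ^ 3 = x ^ 3 + y ^ 3 + 3 * (x ^ 2 * y + x * y ^ 2)"
    by (simp add: power2_eq_square power3_eq_cube algebra_simps)
  then show ?thesis using assms by simp
qed

lemma cube_diff_char3: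
  fixes x y :: "'a::comm_ring_1"
  assumes "(3::'a) = 0"
  shows "(x - y) ^ 3 = x ^ 3 - y ^ 3"
  using cube_add_char3[OF assms, of x "- y"] by simp

lemma mpoly3_char3: "(3::'k::comm_ring_1) = 0 \<Longrightarrow> (3::'k mpoly3) = 0"
  by (metis single_numeral single_zero)

lemma linear_form_cube_char3:
  fixes A B G :: "'k::comm_ring_1"
  assumes "(3::'k) = 0"
  shows "linear_form A B G ^ 3 = diagonal_cubic (A ^ 3) (B ^ 3) (G ^ 3)"
  by (simp add: linear_form_def diagonal_cubic_def cube_add_char3[OF mpoly3_char3[OF assms]]
      mconst_power power_mult_distrib)



section \<open>Substitution of an explicit matrix\<close>

abbreviation mat3 :: "'k \<Rightarrow> 'k \<Rightarrow> 'k \<Rightarrow> 'k \<Rightarrow> 'k \<Rightarrow> 'k \<Rightarrow> 'k \<Rightarrow> 'k \<Rightarrow> 'k \<Rightarrow> 'k::zero^3^3" where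
  "mat3 m11 m12 m13 m21 m22 m23 m31 m32 m33 \<equiv>
     vector [vector [m11, m12, m13], vector [m21, m22, m23], vector [m31, m32, m33]]"

lemma mat3_cases:
  obtains m11 m12 m13 m21 m22 m23 m31 m32 m33
  where "M = mat3 m11 m12 m13 m21 m22 m23 m31 m32 m33"
proof -
  let ?m = "\<lambda>i j. M $ i $ j"
  have "M = mat3 (?m 1 1) (?m 1 2) (?m 1 3) (?m 2 1) (?m 2 2) (?m 2 3) (?m 3 1) (?m 3 2) (?m 3 3)"
    by (simp add: vec_eq_iff forall_3)
  then show ?thesis by (rule that)
qed

lemma mconst_diff: "mconst (a - b) = mconst a - mconst b"
  by (simp add: mconst_def single_diff)

lemma linear_subst_diff: "linear_subst M (F - G) = linear_subst M F - linear_subst M G"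
  using linear_subst_add[of M "F - G" G] by (simp add: algebra_simps)

lemma linear_form_mult:
  "linear_form u1 u2 u3 * linear_form v1 v2 v3 =
   quadratic_form (u1 * v1) (u2 * v2) (u3 * v3)
     (u1 * v2 + u2 * v1) (u1 * v3 + u3 * v1) (u2 * v3 + u3 * v2)"
  by (simp add: linear_form_def quadratic_form_def mconst_add mconst_mult power2_eq_square algebra_simps)

lemma quadratic_form_diff:
  "quadratic_form a b c d e f - quadratic_form a' b' c' d' e' f' =
   quadratic_form (a - a') (b - b') (c - c') (d - d') (e - e') (f - f')"
  by (simp add: quadratic_form_def mconst_diff algebra_simps)

lemma conic_eq: "quadratic_form 1 0 0 0 0 (- 1) = var_x ^ 2 - var_y * var_z"
  by (simp add: quadratic_form_def mconst_def single_uminus)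

lemma line_pair_eq: "quadratic_form 0 0 0 1 0 0 = var_x * var_y"
  by (simp add: quadratic_form_def mconst_def)

context
  fixes M :: "'k::comm_ring_1^3^3" and m11 m12 m13 m21 m22 m23 m31 m32 m33 :: 'k
  defines "M \<equiv> mat3 m11 m12 m13 m21 m22 m23 m31 m32 m33"
begin

lemma linear_subst_mat3_mvar:
  "linear_subst M var_x = linear_form m11 m12 m13"
  "linear_subst M var_y = linear_form m21 m22 m23"
  "linear_subst M var_z = linear_form m31 m32 m33"
  by (simp_all only: linear_subst_mvar M_def vector_3)

lemma linear_subst_linear_form:
  "linear_subst M (linear_form l1 l2 l3) =
   linear_form (l1 * m11 + l2 * m21 + l3 * m31) (l1 * m12 + l2 * m22 + l3 * m32)
     (l1 * m13 + l2 * m23 + l3 * m33)"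
  unfolding linear_form_def[of l1] linear_subst_add linear_subst_mult linear_subst_mconst
    linear_subst_mat3_mvar
  by (simp add: linear_form_def mconst_add mconst_mult algebra_simps)

text \<open>Cubing is additive, so the cubic transforms like a linear form under the matrix of cubed
  entries, and no mixed monomials arise.\<close>

lemma linear_subst_diagonal_cubic:
  assumes "(3::'k) = 0"
  shows "linear_subst M (diagonal_cubic p1 p2 p3) =
   diagonal_cubic (p1 * m11 ^ 3 + p2 * m21 ^ 3 + p3 * m31 ^ 3)
     (p1 * m12 ^ 3 + p2 * m22 ^ 3 + p3 * m32 ^ 3) (p1 * m13 ^ 3 + p2 * m23 ^ 3 + p3 * m33 ^ 3)"
  unfolding diagonal_cubic_def[of p1] linear_subst_add linear_subst_mult linear_subst_mconst
    linear_subst_power linear_subst_mat3_mvar linear_form_cube_char3[OF assms]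
  by (simp add: diagonal_cubic_def mconst_add mconst_mult algebra_simps)

lemma linear_subst_conic:
  "linear_subst M (quadratic_form 1 0 0 0 0 (- 1)) =
   quadratic_form (m11 ^ 2 - m21 * m31) (m12 ^ 2 - m22 * m32) (m13 ^ 2 - m23 * m33)
     (2 * m11 * m12 - (m21 * m32 + m22 * m31)) (2 * m11 * m13 - (m21 * m33 + m23 * m31))
     (2 * m12 * m13 - (m22 * m33 + m23 * m32))"
proof -
  have "u * v + v * u = 2 * u * v" for u v :: 'k by (simp add: mult.commute)
  then show ?thesis
    unfolding conic_eq power2_eq_square linear_subst_diff linear_subst_mult linear_subst_mat3_mvar
      linear_form_mult quadratic_form_diff by (simp add: mult.assoc)
qed

lemma linear_subst_line_pair:
  "linear_subst M (quadratic_form 0 0 0 1 0 0) =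
   quadratic_form (m11 * m21) (m12 * m22) (m13 * m23)
     (m11 * m22 + m12 * m21) (m11 * m23 + m13 * m21) (m12 * m23 + m13 * m22)"
  unfolding line_pair_eq linear_subst_mult linear_subst_mat3_mvar linear_form_mult ..

lemma linear_subst_quartic:
  assumes "(3::'k) = 0"
    and "linear_subst M (quadratic_form a b c d e f) = quadratic_form a' b' c' d' e' f'"
  shows "linear_subst M (quartic k (a, b, c, d, e, f) (p1, p2, p3) (l1, l2, l3)) =
    quartic k (a', b', c', d', e', f')
      (p1 * m11 ^ 3 + p2 * m21 ^ 3 + p3 * m31 ^ 3, p1 * m12 ^ 3 + p2 * m22 ^ 3 + p3 * m32 ^ 3,
       p1 * m13 ^ 3 + p2 * m23 ^ 3 + p3 * m33 ^ 3)
      (l1 * m11 + l2 * m21 + l3 * m31, l1 * m12 + l2 * m22 + l3 * m32,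
       l1 * m13 + l2 * m23 + l3 * m33)"
  unfolding quartic.simps linear_subst_add linear_subst_mult linear_subst_power linear_subst_mconst
    linear_subst_linear_form linear_subst_diagonal_cubic[OF assms(1)] assms(2) ..

end

section \<open>Presentations of a quartic with a prescribed quadratic form\<close>

text \<open>Let \<open>S\<close> be the Gram matrix of the quadratic form, with diagonal
  \<open>a, b, c\<close> and off-diagonal entries \<open>-d, -e, -f\<close> (as
  \<open>1/2 = -1\<close>), and \<open>S'\<close> that of \<open>x^2 - y z\<close>. The six mixed
  coefficients give \<open>k adj S = k' adj S'\<close>, and the identity
  \<open>S adj S = det S I\<close> recovers \<open>S\<close> from its adjugate.\<close>

lemma quartic_conic_eq:
  fixes k k' :: "'k::field"
  assumes char3: "(3::'k) = 0" and k: "k \<noteq> 0" "k' \<noteq> 0"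
    and eq: "quartic k (a, b, c, d, e, f) (p1, p2, p3) (l1, l2, l3) =
      quartic k' (1, 0, 0, 0, 0, - 1) (p1', p2', p3') (l1', l2', l3')"
  shows "a \<noteq> 0" "b = 0" "c = 0" "d = 0" "e = 0" "f = - a"
    "p1 * l1 = p1' * l1'" "p1 * l2 = p1' * l2'" "p1 * l3 = p1' * l3'"
    "p2 * l1 = p2' * l1'" "p2 * l2 = p2' * l2'" "p2 * l3 = p2' * l3'"
    "p3 * l1 = p3' * l1'" "p3 * l2 = p3' * l2'" "p3 * l3 = p3' * l3'"
proof -
  have two: "(2::'k) = - 1" using char3 by (simp add: eq_neg_iff_add_eq_0)
  note E = quartic_eqD[OF eq]
  have e1: "d ^ 2 = a * b" and e2: "e ^ 2 = a * c"
    using E(10,11) k by (simp_all add: two)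
  have e3: "k * (f ^ 2 - b * c) = k'"
    using E(12) by (simp add: two)
  have e4: "k * (a * f + d * e) = - k'"
    using E(13) by (simp add: two minus_equation_iff[of _ k'])
  have e5: "b * e + d * f = 0" and e6: "c * d + e * f = 0"
    using E(14,15) k by (simp_all add: two)
  show a: "a \<noteq> 0" using e1 e4 k by auto
  \<comment> \<open>This is entry (1,3) of \<open>S adj S = det S I\<close>; the factor
    \<open>a * f + d * e\<close> equals \<open>- k' / k\<close> and is nonzero. Entry (1,2) yields
    \<open>e = 0\<close> in the same way.\<close>
  have key: "d * (a * f + d * e) = 0"
  proof -
    have "d * (a * f + d * e) = a * (b * e + d * f) + (d ^ 2 - a * b) * e"
      by (simp add: algebra_simps power2_eq_square)
    then show ?thesis using e1 e5 by simp
  qed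
  then show d: "d = 0" using e4 k by auto
  have "e * (a * f + d * e) = a * (c * d + e * f) + (e ^ 2 - a * c) * d"
    by (simp add: algebra_simps power2_eq_square)
  then have "e * (a * f + d * e) = 0" using e2 e6 by simp
  then show e: "e = 0" using e4 k by auto
  show b: "b = 0" and c: "c = 0" using e1 e2 a d e by simp_all
  \<comment> \<open>Adding the \<open>y^2 z^2\<close> and \<open>x^2 y z\<close> equations
    eliminates \<open>k'\<close>; the root \<open>f = 0\<close> is then excluded.\<close>
  have "k * f * (f + a) = k * (f ^ 2 - b * c) + k * (a * f + d * e)"
    by (simp add: b d algebra_simps power2_eq_square)
  then have "k * f * (f + a) = 0" unfolding e3 e4 by simp
  moreover have "f \<noteq> 0" using e4 k d by auto
  ultimately show f: "f = - a" using k by (simp add: eq_neg_iff_add_eq_0)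
  \<comment> \<open>Now the two squared parts coincide, so the nine remaining equations compare only
    the products of the cubics with the lines.\<close>
  have k': "k' = k * a ^ 2" using e3 b f by simp
  show "p1 * l1 = p1' * l1'" using E(1) by (simp add: k' b c d e)
  show "p1 * l2 = p1' * l2'" using E(2) by (simp add: k' b c d e)
  show "p1 * l3 = p1' * l3'" using E(3) by (simp add: k' b c d e)
  show "p2 * l1 = p2' * l1'" using E(4) by (simp add: k' b c d e)
  show "p2 * l2 = p2' * l2'" using E(5) by (simp add: k' b c d e)
  show "p2 * l3 = p2' * l3'" using E(6) by (simp add: k' b c d e)
  show "p3 * l1 = p3' * l1'" using E(7) by (simp add: k' b c d e)
  show "p3 * l2 = p3' * l2'" using E(8) by (simp add: k' b c d e)
  show "p3 * l3 = p3' * l3'" using E(9) by (simp add: k' b c d e)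
qed

text \<open>The mixed coefficients give only \<open>c = e = f = 0\<close>. Since \<open>p3'\<close>
  is nonzero, the coefficients divisible by \<open>z^3\<close> then force the line to be a multiple
  of \<open>z\<close>; after that the \<open>x^4\<close> and \<open>y^4\<close> coefficients are
  \<open>k a^2\<close> and \<open>k b^2\<close> and must vanish.\<close>

lemma quartic_line_pair_eq:
  fixes k k' :: "'k::field"
  assumes char3: "(3::'k) = 0" and k: "k \<noteq> 0" "k' \<noteq> 0" and p3': "p3' \<noteq> 0"
    and eq: "quartic k (a, b, c, d, e, f) (p1, p2, p3) (l1, l2, l3) =
      quartic k' (0, 0, 0, 1, 0, 0) (p1', p2', p3') (0, 0, 1)"
  shows "a = 0" "b = 0" "c = 0" "d \<noteq> 0" "e = 0" "f = 0" "l1 = 0" "l2 = 0" "l3 \<noteq> 0"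
proof -
  have two: "(2::'k) = - 1" using char3 by (simp add: eq_neg_iff_add_eq_0)
  note E = quartic_eqD[OF eq]
  have e1: "e ^ 2 = a * c" and e2: "f ^ 2 = b * c"
    using E(11,12) k by (simp_all add: two)
  have e3: "k * (d ^ 2 - a * b) = k'"
    using E(10) by (simp add: two)
  have e6: "c * d + e * f = 0"
    using E(15) k by (simp_all add: two)
  \<comment> \<open>Multiplying the \<open>x^2 y^2\<close> equation by \<open>c^2\<close> makes its
    two terms cancel: both \<open>(c d)^2\<close> and \<open>(a c)(b c)\<close> equal
    \<open>e^2 f^2\<close>.\<close>
  have "k' * c ^ 2 = k * (d ^ 2 - a * b) * c ^ 2" using e3 by simp
  also have "\<dots> = k * ((c * d) ^ 2 - (a * c) * (b * c))"
    by (simp add: algebra_simps power2_eq_square)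
  also have "(c * d) ^ 2 = (a * c) * (b * c)"
  proof -
    have "c * d = - (e * f)" using e6 by (simp only: eq_neg_iff_add_eq_0)
    then have "(c * d) ^ 2 = e ^ 2 * f ^ 2" by (simp only: power2_minus power_mult_distrib)
    then show ?thesis unfolding e1 e2 .
  qed
  finally have "k' * c ^ 2 = 0" by simp
  then show c: "c = 0" using k by simp
  then show e: "e = 0" and f: "f = 0" using e1 e2 by simp_all
  have "p3 * l3 = p3'" using E(9) c by simp
  with p3' have p3: "p3 \<noteq> 0" and "l3 \<noteq> 0" by auto
  then show "l3 \<noteq> 0" by simp
  show l1: "l1 = 0" and l2: "l2 = 0" using E(7,8) c p3 by simp_all
  show a: "a = 0" and b: "b = 0" using E(1,5) l1 l2 k by simp_all
  show "d \<noteq> 0" using e3 k a by auto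
qed

section \<open>Curves and their equations\<close>

lemma equation_eq_quartic:
  fixes A B G :: "'k::comm_ring_1"
  assumes "(3::'k) = 0"
  shows "mconst k * (var_x ^ 2 - var_y * var_z) ^ 2 + linear_form A B G ^ 3 * var_x =
      quartic k (1, 0, 0, 0, 0, - 1) (A ^ 3, B ^ 3, G ^ 3) (1, 0, 0)"
    and "mconst k * (var_x ^ 2 - var_y * var_z) ^ 2 + linear_form A B G ^ 3 * var_z =
      quartic k (1, 0, 0, 0, 0, - 1) (A ^ 3, B ^ 3, G ^ 3) (0, 0, 1)"
    and "mconst k * (var_x * var_y) ^ 2 + linear_form A B G ^ 3 * var_z =
      quartic k (0, 0, 0, 1, 0, 0) (A ^ 3, B ^ 3, G ^ 3) (0, 0, 1)"
proof -
  have "linear_form 1 0 0 = (var_x :: 'k mpoly3)" "linear_form 0 0 1 = (var_z :: 'k mpoly3)"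
    by (simp_all add: linear_form_def mconst_def)
  then show "mconst k * (var_x ^ 2 - var_y * var_z) ^ 2 + linear_form A B G ^ 3 * var_x =
      quartic k (1, 0, 0, 0, 0, - 1) (A ^ 3, B ^ 3, G ^ 3) (1, 0, 0)"
    and "mconst k * (var_x ^ 2 - var_y * var_z) ^ 2 + linear_form A B G ^ 3 * var_z =
      quartic k (1, 0, 0, 0, 0, - 1) (A ^ 3, B ^ 3, G ^ 3) (0, 0, 1)"
    and "mconst k * (var_x * var_y) ^ 2 + linear_form A B G ^ 3 * var_z =
      quartic k (0, 0, 0, 1, 0, 0) (A ^ 3, B ^ 3, G ^ 3) (0, 0, 1)"
    unfolding linear_form_cube_char3[OF assms] by (simp_all add: conic_eq line_pair_eq)
qed

lemmas monic_equation_eq_quartic =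
  equation_eq_quartic[where k = 1, unfolded mconst_def[of 1] single_one mult_1_left]

text \<open>Descent to \<open>K\<close>: the cubes of \<open>A\<close>, \<open>B\<close>,
  \<open>G\<close> have preimages under \<open>to_ac\<close>, and extension of scalars is injective
  on polynomials.\<close>

lemma has_equation_quarticE:
  assumes "has_equation C (quartic (to_ac k) (to_ac a, to_ac b, to_ac c, to_ac d, to_ac e, to_ac f)
      (A ^ 3, B ^ 3, G ^ 3) (to_ac l1, to_ac l2, to_ac l3))"
    and "A \<in> cube_root_field" "B \<in> cube_root_field" "G \<in> cube_root_field"
  obtains p1 p2 p3 where "to_ac p1 = A ^ 3" "to_ac p2 = B ^ 3" "to_ac p3 = G ^ 3"
    "quartic k (a, b, c, d, e, f) (p1, p2, p3) (l1, l2, l3) \<in> C"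
proof -
  obtain p1 p2 p3 where p: "to_ac p1 = A ^ 3" "to_ac p2 = B ^ 3" "to_ac p3 = G ^ 3"
    using assms(2-4) by (auto simp: cube_root_field_def base_field_def image_iff)
  obtain F where F: "F \<in> C" and "Poly_Mapping.map to_ac F = quartic (to_ac k)
      (to_ac a, to_ac b, to_ac c, to_ac d, to_ac e, to_ac f) (A ^ 3, B ^ 3, G ^ 3)
      (to_ac l1, to_ac l2, to_ac l3)"
    using assms(1) by (auto simp: has_equation_def)
  then have "Poly_Mapping.map to_ac F =
      Poly_Mapping.map to_ac (quartic k (a, b, c, d, e, f) (p1, p2, p3) (l1, l2, l3))"
    by (simp only: map_to_ac_quartic p)
  then have "F = quartic k (a, b, c, d, e, f) (p1, p2, p3) (l1, l2, l3)"
    by (simp only: map_to_ac_eq_iff)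
  with F p that show thesis by blast
qed

lemma has_equation_quarticI:
  assumes "quartic k (a, b, c, d, e, f) (p1, p2, p3) (l1, l2, l3) \<in> C"
  shows "has_equation C (quartic (to_ac k) (to_ac a, to_ac b, to_ac c, to_ac d, to_ac e, to_ac f)
      (to_ac p1, to_ac p2, to_ac p3) (to_ac l1, to_ac l2, to_ac l3))"
  using assms unfolding has_equation_def map_to_ac_quartic[symmetric] by blast

lemma three_alg_closure: "(3::'k::field) = 0 \<Longrightarrow> (3::'k alg_closure) = 0"
  by (metis to_ac_0 to_ac_numeral)

lemma cube_root_field_mult:
  "s \<in> cube_root_field \<Longrightarrow> t \<in> cube_root_field \<Longrightarrow> s * t \<in> cube_root_field"
  by (auto simp: cube_root_field_def base_field_def power_mult_distrib simp flip: to_ac_mult)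

lemma cube_root_field_diff:
  assumes "(3::'k::field) = 0"
  shows "s \<in> cube_root_field \<Longrightarrow> t \<in> cube_root_field \<Longrightarrow> s - t \<in> (cube_root_field :: 'k alg_closure set)"
  by (auto simp: cube_root_field_def base_field_def cube_diff_char3[OF three_alg_closure[OF assms]]
      simp flip: to_ac_diff)

lemma cube_root_field_uminus: "t \<in> cube_root_field \<Longrightarrow> - t \<in> cube_root_field"
  by (auto simp: cube_root_field_def base_field_def simp flip: to_ac_minus)

text \<open>Of \<open>t1\<close> and \<open>t2\<close> only the consequence
  \<open>p2 \<noteq> 0\<close> is kept, where \<open>p2\<close> corresponds to
  \<open>(t2 - t1)^3\<close>. A nonzero cubic coefficient is what later makes the line
  recoverable.\<close>

lemma family0E:
  fixes C :: "'k::field mpoly3 set"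
  assumes char3: "(3::'k) = 0" and "C \<in> family0"
  obtains k p1 p2 p3 where "C \<in> plane_curves 4" "k \<noteq> 0" "p2 \<noteq> 0"
    "quartic k (1, 0, 0, 0, 0, - 1) (p1, p2, p3) (1, 0, 0) \<in> C"
proof -
  note char3' = three_alg_closure[OF char3]
  obtain t1 t2 and a :: 'k where t: "t1 \<noteq> t2" "t1 \<in> cube_root_field" "t2 \<in> cube_root_field"
    and C: "C \<in> plane_curves 4" and a: "a \<noteq> 0"
    and eq: "has_equation C (mconst (to_ac a) * (var_x^2 - var_y * var_z)^2
        + (linear_form (t1^2 - t2^2) (t2 - t1) (t1 * t2^2 - t2 * t1^2))^3 * var_x)"
    using assms(2) unfolding family0_def by blast
  have "has_equation C (quartic (to_ac a)
      (to_ac 1, to_ac 0, to_ac 0, to_ac 0, to_ac 0, to_ac (- 1))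
      ((t1^2 - t2^2) ^ 3, (t2 - t1) ^ 3, (t1 * t2^2 - t2 * t1^2) ^ 3) (to_ac 1, to_ac 0, to_ac 0))"
    using eq unfolding equation_eq_quartic[OF char3'] by simp
  moreover have "t1^2 - t2^2 \<in> cube_root_field" "t2 - t1 \<in> cube_root_field"
      "t1 * t2^2 - t2 * t1^2 \<in> cube_root_field"
    using t by (simp_all add: power2_eq_square cube_root_field_mult cube_root_field_diff[OF char3])
  ultimately obtain p1 p2 p3 where p2: "to_ac p2 = (t2 - t1) ^ 3"
    and "quartic a (1, 0, 0, 0, 0, - 1) (p1, p2, p3) (1, 0, 0) \<in> C"
    by (rule has_equation_quarticE)
  moreover have "p2 \<noteq> 0" using p2 t(1) by (metis right_minus_eq power_not_zero to_ac_0)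
  ultimately show thesis using that C a by blast
qed

lemma family1E:
  fixes C :: "'k::field mpoly3 set"
  assumes char3: "(3::'k) = 0" and "C \<in> family1"
  obtains k p1 p2 p3 where "C \<in> plane_curves 4" "k \<noteq> 0" "p2 \<noteq> 0"
    "quartic k (1, 0, 0, 0, 0, - 1) (p1, p2, p3) (0, 0, 1) \<in> C"
proof -
  note char3' = three_alg_closure[OF char3]
  obtain t1 t2 and a :: 'k where t: "t1 \<noteq> t2" "t1 \<in> cube_root_field" "t2 \<in> cube_root_field"
    and C: "C \<in> plane_curves 4" and a: "a \<noteq> 0"
    and eq: "has_equation C (mconst (to_ac a) * (var_x^2 - var_y * var_z)^2
        + (linear_form (t1^2 - t2^2) (t2 - t1) (t1 * t2^2 - t2 * t1^2))^3 * var_z)"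
    using assms(2) unfolding family1_def by blast
  have "has_equation C (quartic (to_ac a)
      (to_ac 1, to_ac 0, to_ac 0, to_ac 0, to_ac 0, to_ac (- 1))
      ((t1^2 - t2^2) ^ 3, (t2 - t1) ^ 3, (t1 * t2^2 - t2 * t1^2) ^ 3) (to_ac 0, to_ac 0, to_ac 1))"
    using eq unfolding equation_eq_quartic[OF char3'] by simp
  moreover have "t1^2 - t2^2 \<in> cube_root_field" "t2 - t1 \<in> cube_root_field"
      "t1 * t2^2 - t2 * t1^2 \<in> cube_root_field"
    using t by (simp_all add: power2_eq_square cube_root_field_mult cube_root_field_diff[OF char3])
  ultimately obtain p1 p2 p3 where p2: "to_ac p2 = (t2 - t1) ^ 3"
    and "quartic a (1, 0, 0, 0, 0, - 1) (p1, p2, p3) (0, 0, 1) \<in> C"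
    by (rule has_equation_quarticE)
  moreover have "p2 \<noteq> 0" using p2 t(1) by (metis right_minus_eq power_not_zero to_ac_0)
  ultimately show thesis using that C a by blast
qed

text \<open>Here \<open>p3\<close> corresponds to the cube of \<open>- (t1 * t2)\<close>; it is
  nonzero because 0 lies in \<open>base_field\<close>, which contains neither \<open>t1\<close> nor
  \<open>t2\<close>.\<close>

lemma family2E:
  fixes C :: "'k::field mpoly3 set"
  assumes char3: "(3::'k) = 0" and "C \<in> family2"
  obtains k p1 p2 p3 where "C \<in> plane_curves 4" "k \<noteq> 0" "p3 \<noteq> 0"
    "quartic k (0, 0, 0, 1, 0, 0) (p1, p2, p3) (0, 0, 1) \<in> C"
proof -
  note char3' = three_alg_closure[OF char3]
  obtain t1 t2 and a :: 'k where t: "t1 \<in> cube_root_field" "t2 \<in> cube_root_field"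
      "t1 \<notin> base_field" "t2 \<notin> base_field"
    and C: "C \<in> plane_curves 4" and a: "a \<noteq> 0"
    and eq: "has_equation C (mconst (to_ac a) * (var_x * var_y)^2
        + (linear_form t1 t2 (- (t1 * t2)))^3 * var_z)"
    using assms(2) unfolding family2_def by blast
  have "has_equation C (quartic (to_ac a)
      (to_ac 0, to_ac 0, to_ac 0, to_ac 1, to_ac 0, to_ac 0)
      (t1 ^ 3, t2 ^ 3, (- (t1 * t2)) ^ 3) (to_ac 0, to_ac 0, to_ac 1))"
    using eq unfolding equation_eq_quartic[OF char3'] by simp
  moreover note t(1,2)
  moreover have "- (t1 * t2) \<in> cube_root_field"
    using t by (simp add: cube_root_field_mult cube_root_field_uminus)
  ultimately obtain p1 p2 p3 where p3: "to_ac p3 = (- (t1 * t2)) ^ 3"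
    and "quartic a (0, 0, 0, 1, 0, 0) (p1, p2, p3) (0, 0, 1) \<in> C"
    by (rule has_equation_quarticE)
  moreover have "t1 \<noteq> 0" "t2 \<noteq> 0"
    using t(3,4) unfolding base_field_def by (metis rangeI to_ac_0)+
  then have "p3 \<noteq> 0" using p3 by auto
  ultimately show thesis using that C a by blast
qed

text \<open>All members of \<open>C'\<close> are multiples of one form, so the substituted equation
  and a chosen equation \<open>F'\<close> differ by a scalar \<open>c\<close>.\<close>

lemma relates_pullback:
  fixes C :: "'k::field mpoly3 set"
  assumes "relates T C C'" "C' \<in> plane_curves n" "F \<in> C" "F' \<in> C'"
  obtains M c where "T = projectivity M" "c \<noteq> 0" "linear_subst M F = mconst c * F'"
proof -
  obtain M where T: "T = projectivity M"
    using assms(1) by (auto simp: relates_def plane_automorphisms_def)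
  have "M \<in> T" unfolding T projectivity_def by (auto intro!: exI[of _ 1] simp: vec_eq_iff)
  then have "linear_subst M F \<in> C'"
    using assms(1,3) unfolding relates_def curve_pullback_def by blast
  moreover obtain F0 where "C' = curve_of F0"
    using assms(2) by (auto simp: plane_curves_def)
  ultimately obtain c1 c2 where c: "c1 \<noteq> 0" "c2 \<noteq> 0"
    and "linear_subst M F = mconst c1 * F0" and F': "F' = mconst c2 * F0"
    using assms(4) unfolding curve_of_def by blast
  moreover have "mconst c1 * F0 = mconst (c1 / c2) * F'"
    using c by (simp add: F' mult.assoc[symmetric] mconst_mult[symmetric])
  ultimately show thesis using that[OF T, of "c1 / c2"] by simp
qed

lemma linear_subst_in_pullback:
  assumes "relates (projectivity N) C C'" "F \<in> C"
  shows "linear_subst N F \<in> C'"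
proof -
  have "N \<in> projectivity N"
    unfolding projectivity_def by (auto intro!: exI[of _ 1] simp: vec_eq_iff)
  then show ?thesis using assms unfolding relates_def curve_pullback_def by blast
qed

lemma projectivity_scale:
  assumes "s \<noteq> 0"
  shows "projectivity (\<chi> i j. s * N $ i $ j) = projectivity N"
proof (intro subset_antisym subsetI)
  fix P assume "P \<in> projectivity (\<chi> i j. s * N $ i $ j)"
  then obtain c where "c \<noteq> 0" "P = (\<chi> i j. (c * s) * N $ i $ j)"
    by (auto simp: projectivity_def mult.assoc)
  then show "P \<in> projectivity N" unfolding projectivity_def using assms by force
next
  fix P assume "P \<in> projectivity N"
  then obtain c where "c \<noteq> 0" "P = (\<chi> i j. c * N $ i $ j)" by (auto simp: projectivity_def)
  then have "c / s \<noteq> 0" "P = (\<chi> i j. (c / s) * (\<chi> i j. s * N $ i $ j) $ i $ j)"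
    using assms by simp_all
  then show "P \<in> projectivity (\<chi> i j. s * N $ i $ j)" unfolding projectivity_def by blast
qed

lemma projectivity_mat3_scale:
  fixes s :: "'k::field"
  assumes "s \<noteq> 0" "m11 = s * n11" "m12 = s * n12" "m13 = s * n13" "m21 = s * n21"
    "m22 = s * n22" "m23 = s * n23" "m31 = s * n31" "m32 = s * n32" "m33 = s * n33"
  shows "projectivity (mat3 m11 m12 m13 m21 m22 m23 m31 m32 m33) =
    projectivity (mat3 n11 n12 n13 n21 n22 n23 n31 n32 n33)"
    (is "projectivity ?M = projectivity ?N")
proof -
  have "?M $ i $ j = s * ?N $ i $ j" for i j
    using exhaust_3[of i] exhaust_3[of j] by (auto simp: assms(2-))
  then have "?M = (\<chi> i j. s * ?N $ i $ j)" by (simp add: vec_eq_iff)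
  then show ?thesis using projectivity_scale[OF assms(1)] by simp
qed

section \<open>Cube roots in the closure and square roots in \<open>K\<close>\<close>

text \<open>Existence comes from algebraic closedness, uniqueness from
  \<open>s^3 - r^3 = (s - r)^3\<close>.\<close>

lemma cbrt_cube:
  assumes "(3::'k::field) = 0"
  shows "cbrt (c::'k) ^ 3 = to_ac c"
proof -
  obtain r :: "'k alg_closure" where r: "r ^ 3 = to_ac c"
    using nth_root_exists[of 3 "to_ac c"] by auto
  moreover have "s = r" if "s ^ 3 = to_ac c" for s
    using cube_diff_char3[OF three_alg_closure[OF assms], of s r] r that by simp
  ultimately show ?thesis unfolding cbrt_def by (rule theI)
qed

text \<open>If \<open>c\<close> had no square root, \<open>X^2 - c\<close> would be irreducible,
  being quadratic without a root, and also separable because \<open>2 c\<close> is nonzero.\<close>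

lemma sqrt_exists_if_separably_closed:
  assumes sc: "separably_closed_field TYPE('k::field)" and two: "(2::'k) \<noteq> 0"
  shows "\<exists>r::'k. r ^ 2 = c"
proof (rule ccontr)
  assume no_root: "\<nexists>r. r ^ 2 = c"
  then have c: "c \<noteq> 0" by (metis zero_power2)
  define p where "p = [:- c, 0, 1:]"
  have deg: "degree p = 2" by (simp add: p_def)
  have no_factor: "degree a \<noteq> 1" if "a dvd p" for a
  proof
    assume "degree a = 1"
    then obtain u v where a: "a = [:u, v:]" "v \<noteq> 0" by (metis degree1_coeffs)
    then have "poly a (- u / v) = 0" by simp
    with that have "poly p (- u / v) = 0" by (metis dvd_trans poly_eq_0_iff_dvd)
    then have "(- u / v) ^ 2 = c" by (simp add: p_def power2_eq_square)
    then show False using no_root by blast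
  qed
  have "irreducible p"
  proof (rule irreducibleI)
    show "p \<noteq> 0" using deg by auto
    then show "\<not> p dvd 1" using deg by (simp add: is_unit_iff_degree)
    fix a b assume p: "p = a * b"
    then have ab: "a \<noteq> 0" "b \<noteq> 0" using deg by auto
    then have "degree a + degree b = 2" using deg p by (simp add: degree_mult_eq)
    moreover have "degree a \<noteq> 1" using no_factor p by simp
    ultimately have "degree a = 0 \<or> degree b = 0" by linarith
    then show "a dvd 1 \<or> b dvd 1" using ab by (simp add: is_unit_iff_degree)
  qed
  moreover have "separable_poly p"
    unfolding separable_poly_def
  proof (rule coprimeI)
    fix d assume "d dvd p" "d dvd pderiv p"
    \<comment> \<open>Bezout identity:
      \<open>(-1/c) (X^2 - c) + (X / (2 c)) (2 X) = 1\<close>.\<close>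
    then have "d dvd [:- 1 / c:] * p + [:0, 1 / (2 * c):] * pderiv p" by (intro dvd_add dvd_mult)
    also have "[:- 1 / c:] * p + [:0, 1 / (2 * c):] * pderiv p = 1"
      using c two by (simp add: p_def pderiv_pCons)
    finally show "d dvd 1" .
  qed
  ultimately show False using sc deg unfolding separably_closed_field_def by fastforce
qed

section \<open>Automorphisms between the curves\<close>

lemma relates_quarticE:
  fixes C :: "'k::field mpoly3 set"
  assumes "relates T C C'" "C' \<in> plane_curves n" "quartic k q p l \<in> C"
    "quartic k' q' (p1', p2', p3') l' \<in> C'"
  obtains m11 m12 m13 m21 m22 m23 m31 m32 m33 c
  where "T = projectivity (mat3 m11 m12 m13 m21 m22 m23 m31 m32 m33)" "c \<noteq> 0"
    "linear_subst (mat3 m11 m12 m13 m21 m22 m23 m31 m32 m33) (quartic k q p l) =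
     quartic (c * k') q' (c * p1', c * p2', c * p3') l'"
proof -
  obtain M c where "T = projectivity M" "c \<noteq> 0"
    "linear_subst M (quartic k q p l) = mconst c * quartic k' q' (p1', p2', p3') l'"
    using relates_pullback[OF assms] by blast
  then show thesis using that unfolding quartic_scale by (metis mat3_cases)
qed

text \<open>Used to read off a line from the equations \<open>p_i l_j = p_i' l_j'\<close> for one
  fixed index \<open>i\<close> with \<open>p_i'\<close> nonzero.\<close>

lemma proportional_if_same_scaling:
  fixes P r :: "'k::field"
  assumes "P * u1 = r * v1" "P * u2 = r * v2" "P * u3 = r * v3" "r \<noteq> 0"
    and "v1 \<noteq> 0 \<or> v2 \<noteq> 0 \<or> v3 \<noteq> 0"
  obtains s where "s \<noteq> 0" "u1 = s * v1" "u2 = s * v2" "u3 = s * v3"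
proof -
  have "P \<noteq> 0" using assms by auto
  then show thesis using that[of "r / P"] assms by (simp add: field_simps)
qed

text \<open>The line equations come from the \<open>y^3\<close> row of the comparison, because
  \<open>p2'\<close> is the cubic coefficient known to be nonzero. The remaining equations say that
  the conic form is multiplied by \<open>m11^2 - m21 m31\<close>.\<close>

lemma relates_conic_conicE:
  fixes C :: "'k::field mpoly3 set"
  assumes char3: "(3::'k) = 0" and "relates T C C'" "C' \<in> plane_curves n"
    and "k \<noteq> 0" "quartic k (1, 0, 0, 0, 0, - 1) (p1, p2, p3) (l1, l2, l3) \<in> C"
    and "k' \<noteq> 0" "p2' \<noteq> 0" "l1' \<noteq> 0 \<or> l2' \<noteq> 0 \<or> l3' \<noteq> 0"
    and "quartic k' (1, 0, 0, 0, 0, - 1) (p1', p2', p3') (l1', l2', l3') \<in> C'"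
  obtains m11 m12 m13 m21 m22 m23 m31 m32 m33 s
  where "T = projectivity (mat3 m11 m12 m13 m21 m22 m23 m31 m32 m33)" "s \<noteq> 0"
    "l1 * m11 + l2 * m21 + l3 * m31 = s * l1'" "l1 * m12 + l2 * m22 + l3 * m32 = s * l2'"
    "l1 * m13 + l2 * m23 + l3 * m33 = s * l3'"
    "m11 ^ 2 - m21 * m31 \<noteq> 0" "m12 ^ 2 = m22 * m32" "m13 ^ 2 = m23 * m33"
    "2 * m11 * m12 = m21 * m32 + m22 * m31" "2 * m11 * m13 = m21 * m33 + m23 * m31"
    "m22 * m33 + m23 * m32 - 2 * m12 * m13 = m11 ^ 2 - m21 * m31"
proof -
  obtain m11 m12 m13 m21 m22 m23 m31 m32 m33 c
  where T: "T = projectivity (mat3 m11 m12 m13 m21 m22 m23 m31 m32 m33)" and c: "c \<noteq> 0"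
    and eq: "linear_subst (mat3 m11 m12 m13 m21 m22 m23 m31 m32 m33)
        (quartic k (1, 0, 0, 0, 0, - 1) (p1, p2, p3) (l1, l2, l3)) =
      quartic (c * k') (1, 0, 0, 0, 0, - 1) (c * p1', c * p2', c * p3') (l1', l2', l3')"
    by (rule relates_quarticE[OF assms(2,3,5,9)])
  have "c * k' \<noteq> 0" using c assms by simp
  note E = quartic_conic_eq[OF char3 assms(4) this
      eq[unfolded linear_subst_quartic[OF char3 linear_subst_conic]]]
  obtain s where s: "s \<noteq> 0" "l1 * m11 + l2 * m21 + l3 * m31 = s * l1'"
    "l1 * m12 + l2 * m22 + l3 * m32 = s * l2'" "l1 * m13 + l2 * m23 + l3 * m33 = s * l3'"
    using proportional_if_same_scaling[OF E(10-12) _ assms(8)] c assms(7) by auto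
  show thesis
  proof (rule that[OF T s E(1)])
    show "m12 ^ 2 = m22 * m32" "m13 ^ 2 = m23 * m33"
      "2 * m11 * m12 = m21 * m32 + m22 * m31" "2 * m11 * m13 = m21 * m33 + m23 * m31"
      using E(2-5) by simp_all
    have "- (2 * m12 * m13 - (m22 * m33 + m23 * m32)) = m11 ^ 2 - m21 * m31"
      unfolding E(6) by (rule minus_minus)
    then show "m22 * m33 + m23 * m32 - 2 * m12 * m13 = m11 ^ 2 - m21 * m31" by simp
  qed
qed

lemma relates_line_pairE:
  fixes C :: "'k::field mpoly3 set"
  assumes char3: "(3::'k) = 0" and "relates T C C'" "C' \<in> plane_curves n"
    and "k \<noteq> 0" "quartic k (0, 0, 0, 1, 0, 0) (p1, p2, p3) (0, 0, 1) \<in> C"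
    and "k' \<noteq> 0" "p3' \<noteq> 0"
    and "quartic k' (0, 0, 0, 1, 0, 0) (p1', p2', p3') (0, 0, 1) \<in> C'"
  obtains m11 m12 m13 m21 m22 m23 m33
  where "T = projectivity (mat3 m11 m12 m13 m21 m22 m23 0 0 m33)" "m33 \<noteq> 0"
    "m11 * m21 = 0" "m12 * m22 = 0" "m13 * m23 = 0"
    "m11 * m22 + m12 * m21 \<noteq> 0" "m11 * m23 + m13 * m21 = 0" "m12 * m23 + m13 * m22 = 0"
proof -
  obtain m11 m12 m13 m21 m22 m23 m31 m32 m33 c
  where T: "T = projectivity (mat3 m11 m12 m13 m21 m22 m23 m31 m32 m33)" and c: "c \<noteq> 0"
    and eq: "linear_subst (mat3 m11 m12 m13 m21 m22 m23 m31 m32 m33)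
        (quartic k (0, 0, 0, 1, 0, 0) (p1, p2, p3) (0, 0, 1)) =
      quartic (c * k') (0, 0, 0, 1, 0, 0) (c * p1', c * p2', c * p3') (0, 0, 1)"
    by (rule relates_quarticE[OF assms(2,3,5,8)])
  have "c * k' \<noteq> 0" "c * p3' \<noteq> 0" using c assms by simp_all
  note E = quartic_line_pair_eq[OF char3 assms(4) this
      eq[unfolded linear_subst_quartic[OF char3 linear_subst_line_pair]]]
  have "m31 = 0" "m32 = 0" "m33 \<noteq> 0" using E(7-9) by simp_all
  then show thesis using that T E(1-6) by blast
qed

text \<open>The form \<open>x y\<close> pulls back to a product of two linear forms, and no nonzero
  multiple of \<open>x^2 - y z\<close> is such a product.\<close>

lemma not_relates_line_pair_conic:
  fixes C :: "'k::field mpoly3 set"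
  assumes char3: "(3::'k) = 0" and "C' \<in> plane_curves n"
    and "k \<noteq> 0" "quartic k (0, 0, 0, 1, 0, 0) (p1, p2, p3) (l1, l2, l3) \<in> C"
    and "k' \<noteq> 0" "quartic k' (1, 0, 0, 0, 0, - 1) (p1', p2', p3') (l1', l2', l3') \<in> C'"
  shows "\<not> relates T C C'"
proof
  assume "relates T C C'"
  from relates_quarticE[OF this assms(2,4,6)]
  obtain m11 m12 m13 m21 m22 m23 m31 m32 m33 c where c: "c \<noteq> 0"
    and eq: "linear_subst (mat3 m11 m12 m13 m21 m22 m23 m31 m32 m33)
        (quartic k (0, 0, 0, 1, 0, 0) (p1, p2, p3) (l1, l2, l3)) =
      quartic (c * k') (1, 0, 0, 0, 0, - 1) (c * p1', c * p2', c * p3') (l1', l2', l3')" .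
  have "c * k' \<noteq> 0" using c assms by simp
  note E = quartic_conic_eq[OF char3 assms(3) this
      eq[unfolded linear_subst_quartic[OF char3 linear_subst_line_pair]]]
  show False using E(1,2,4,6) by auto
qed

text \<open>The equations for the quadratic form alone give no contradiction: the singular
  substitution of \<open>0, x, -y\<close> for \<open>x, y, z\<close> turns \<open>x^2 - y z\<close>
  into \<open>x y\<close>. The condition that the line is carried to a nonzero multiple of
  \<open>z\<close> excludes such matrices.\<close>

lemma not_relates_conic_line_pair:
  fixes C :: "'k::field mpoly3 set"
  assumes char3: "(3::'k) = 0" and "C' \<in> plane_curves n"
    and "k \<noteq> 0" "quartic k (1, 0, 0, 0, 0, - 1) (p1, p2, p3) l \<in> C"
    and l: "l = (1, 0, 0) \<or> l = (0, 0, 1)"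
    and "k' \<noteq> 0" "p3' \<noteq> 0" "quartic k' (0, 0, 0, 1, 0, 0) (p1', p2', p3') (0, 0, 1) \<in> C'"
  shows "\<not> relates T C C'"
proof
  assume "relates T C C'"
  from relates_quarticE[OF this assms(2,4,8)]
  obtain m11 m12 m13 m21 m22 m23 m31 m32 m33 c where c: "c \<noteq> 0"
    and eq: "linear_subst (mat3 m11 m12 m13 m21 m22 m23 m31 m32 m33)
        (quartic k (1, 0, 0, 0, 0, - 1) (p1, p2, p3) l) =
      quartic (c * k') (0, 0, 0, 1, 0, 0) (c * p1', c * p2', c * p3') (0, 0, 1)" .
  have nz: "c * k' \<noteq> 0" "c * p3' \<noteq> 0" using c assms by simp_all
  obtain l1 l2 l3 where l_eq: "l = (l1, l2, l3)" by (cases l)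
  note E = quartic_line_pair_eq[OF char3 assms(3) nz
      eq[unfolded l_eq linear_subst_quartic[OF char3 linear_subst_conic]]]
  from l show False
  proof
    assume "l = (1, 0, 0)"
    then have "m11 = 0" "m12 = 0" "m13 \<noteq> 0" using E(7-9) by (simp_all add: l_eq)
    then show False using E(1-6) by auto
  next
    assume "l = (0, 0, 1)"
    then have "m31 = 0" "m32 = 0" using E(7,8) by (simp_all add: l_eq)
    then show False using E(1,2,4) by auto
  qed
qed

text \<open>Geometrically, \<open>x = 0\<close> meets the conic in two points while
  \<open>z = 0\<close> is tangent to it.\<close>

lemma not_relates_conic_conic:
  fixes C C' :: "'k::field mpoly3 set"
  assumes char3: "(3::'k) = 0"
    and "C' \<in> plane_curves n" "k \<noteq> 0" "k' \<noteq> 0" "p2' \<noteq> 0"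
    and "quartic k (1, 0, 0, 0, 0, - 1) (p1, p2, p3) l \<in> C"
    and "quartic k' (1, 0, 0, 0, 0, - 1) (p1', p2', p3') l' \<in> C'"
    and "l = (1, 0, 0) \<and> l' = (0, 0, 1) \<or> l = (0, 0, 1) \<and> l' = (1, 0, 0)"
  shows "\<not> relates T C C'"
proof
  assume R: "relates T C C'"
  from assms(8) show False
  proof (elim disjE conjE)
    assume l: "l = (1, 0, 0)" "l' = (0, 0, 1)"
    obtain m11 m12 m13 m21 m22 m23 m31 m32 m33 s where "T = projectivity (mat3 m11 m12 m13 m21 m22 m23 m31 m32 m33)" "s \<noteq> 0"
      and line: "1 * m11 + 0 * m21 + 0 * m31 = s * 0" "1 * m12 + 0 * m22 + 0 * m32 = s * 0" "1 * m13 + 0 * m23 + 0 * m33 = s * 1"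
      and conic: "m11 ^ 2 - m21 * m31 \<noteq> 0" "m12 ^ 2 = m22 * m32" "m13 ^ 2 = m23 * m33"
        "2 * m11 * m12 = m21 * m32 + m22 * m31" "2 * m11 * m13 = m21 * m33 + m23 * m31"
        "m22 * m33 + m23 * m32 - 2 * m12 * m13 = m11 ^ 2 - m21 * m31"
      by (rule relates_conic_conicE[OF char3 R assms(2,3) assms(6)[unfolded l] assms(4,5) disjI2[OF disjI2[OF one_neq_zero]]
        assms(7)[unfolded l]])
    \<comment> \<open>Then \<open>m21\<close> and \<open>m31\<close> are nonzero, so the
      \<open>y^2\<close> and \<open>x y\<close> equations force \<open>m22 = m32 = 0\<close>,
      against the \<open>y z\<close> equation.\<close>
    have "m11 = 0" "m12 = 0" using line by simp_all
    then show False using conic by auto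
  next
    assume l: "l = (0, 0, 1)" "l' = (1, 0, 0)"
    obtain m11 m12 m13 m21 m22 m23 m31 m32 m33 s where "T = projectivity (mat3 m11 m12 m13 m21 m22 m23 m31 m32 m33)" "s \<noteq> 0"
      and line: "0 * m11 + 0 * m21 + 1 * m31 = s * 1" "0 * m12 + 0 * m22 + 1 * m32 = s * 0" "0 * m13 + 0 * m23 + 1 * m33 = s * 0"
      and conic: "m11 ^ 2 - m21 * m31 \<noteq> 0" "m12 ^ 2 = m22 * m32" "m13 ^ 2 = m23 * m33"
        "2 * m11 * m12 = m21 * m32 + m22 * m31" "2 * m11 * m13 = m21 * m33 + m23 * m31"
        "m22 * m33 + m23 * m32 - 2 * m12 * m13 = m11 ^ 2 - m21 * m31"
      by (rule relates_conic_conicE[OF char3 R assms(2,3) assms(6)[unfolded l] assms(4,5) disjI1[OF one_neq_zero]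
        assms(7)[unfolded l]])
    \<comment> \<open>Then \<open>m12 = m13 = 0\<close>, so the \<open>y z\<close> equation makes
      the conic factor vanish.\<close>
    have "m32 = 0" "m33 = 0" using line by simp_all
    then show False using conic by auto
  qed
qed

text \<open>The conic and the line \<open>x = 0\<close> meet in \<open>(0:1:0)\<close> and
  \<open>(0:0:1)\<close>, which \<open>T\<close> fixes or swaps. The second column of the matrix is
  the image of \<open>(0:1:0)\<close>, so the case distinction on \<open>m22\<close> separates the
  two possibilities.\<close>

lemma family0_automorphisms:
  fixes C C' :: "'k::field mpoly3 set"
  assumes char3: "(3::'k) = 0" and "C \<in> family0" "C' \<in> family0" "relates T C C'"
  shows "\<exists>l. l \<noteq> 0 \<and> (T = projectivity (mat3 1 0 0 0 l 0 0 0 (inverse l)) \<or>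
    T = projectivity (mat3 1 0 0 0 0 (inverse l) 0 l 0))"
proof -
  obtain k p1 p2 p3 where C: "k \<noteq> 0" "quartic k (1, 0, 0, 0, 0, - 1) (p1, p2, p3) (1, 0, 0) \<in> C"
    by (rule family0E[OF char3 assms(2)])
  obtain k' p1' p2' p3' where C': "C' \<in> plane_curves 4" "k' \<noteq> 0" "p2' \<noteq> 0"
    "quartic k' (1, 0, 0, 0, 0, - 1) (p1', p2', p3') (1, 0, 0) \<in> C'"
    by (rule family0E[OF char3 assms(3)])
  obtain m11 m12 m13 m21 m22 m23 m31 m32 m33 s
    where T: "T = projectivity (mat3 m11 m12 m13 m21 m22 m23 m31 m32 m33)" and s: "s \<noteq> 0"
      and raw: "1 * m11 + 0 * m21 + 0 * m31 = s * 1" "1 * m12 + 0 * m22 + 0 * m32 = s * 0" "1 * m13 + 0 * m23 + 0 * m33 = s * 0"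
      and conic: "m11 ^ 2 - m21 * m31 \<noteq> 0" "m12 ^ 2 = m22 * m32" "m13 ^ 2 = m23 * m33"
        "2 * m11 * m12 = m21 * m32 + m22 * m31" "2 * m11 * m13 = m21 * m33 + m23 * m31"
        "m22 * m33 + m23 * m32 - 2 * m12 * m13 = m11 ^ 2 - m21 * m31"
    by (rule relates_conic_conicE[OF char3 assms(4) C'(1) C C'(2,3) disjI1[OF one_neq_zero] C'(4)])
  have line: "m11 \<noteq> 0" "m12 = 0" "m13 = 0" using raw s by simp_all
  show ?thesis
  proof (cases "m22 = 0")
    case False
    then have "m32 = 0" using conic(2) line by auto
    then have "m31 = 0" using conic(4) line False by auto
    then have eq: "m22 * m33 = m11 ^ 2" using conic(6) line \<open>m32 = 0\<close> by simp
    then have "m33 \<noteq> 0" using line by auto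
    then have "m23 = 0" using conic(3) line by auto
    then have "m21 = 0" using conic(5) line \<open>m33 \<noteq> 0\<close> by auto
    have "T = projectivity (mat3 1 0 0 0 (m22 / m11) 0 0 0 (inverse (m22 / m11)))"
      unfolding T
      by (rule projectivity_mat3_scale[OF line(1)])
         (use eq line False \<open>m32 = 0\<close> \<open>m31 = 0\<close> \<open>m23 = 0\<close> \<open>m21 = 0\<close>
          in \<open>simp_all add: field_simps power2_eq_square\<close>)
    then show ?thesis using False line(1) by (intro exI[of _ "m22 / m11"]) simp
  next
    case True
    then have "m23 * m32 \<noteq> 0" using conic(1,6) line by auto
    then have nz: "m23 \<noteq> 0" "m32 \<noteq> 0" by auto
    then have "m33 = 0" "m21 = 0" using conic(3,4) line True by auto
    then have "m31 = 0" using conic(5) line nz by auto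
    have eq: "m23 * m32 = m11 ^ 2" using conic(6) line True \<open>m31 = 0\<close> by simp
    have "T = projectivity (mat3 1 0 0 0 0 (inverse (m32 / m11)) 0 (m32 / m11) 0)"
      unfolding T
      by (rule projectivity_mat3_scale[OF line(1)])
         (use eq line nz True \<open>m33 = 0\<close> \<open>m31 = 0\<close> \<open>m21 = 0\<close>
          in \<open>simp_all add: field_simps power2_eq_square\<close>)
    then show ?thesis using nz line(1) by (intro exI[of _ "m32 / m11"]) simp
  qed
qed

text \<open>The line \<open>z = 0\<close> touches the conic at \<open>(0:1:0)\<close>, so
  \<open>T\<close> fixes that point. The maps of the conic fixing a point form a two-parameter
  group, here parametrised by the second row of the matrix.\<close>

lemma family1_automorphisms:
  fixes C C' :: "'k::field mpoly3 set"
  assumes char3: "(3::'k) = 0" and "C \<in> family1" "C' \<in> family1" "relates T C C'"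
  shows "\<exists>l1 l2. l2 \<noteq> 0 \<and>
    T = projectivity (mat3 1 0 (- (l1 / l2)) l1 l2 (l1 ^ 2 / l2) 0 0 (inverse l2))"
proof -
  have two: "(2::'k) = - 1" using char3 by (simp add: eq_neg_iff_add_eq_0)
  obtain k p1 p2 p3 where C: "k \<noteq> 0" "quartic k (1, 0, 0, 0, 0, - 1) (p1, p2, p3) (0, 0, 1) \<in> C"
    by (rule family1E[OF char3 assms(2)])
  obtain k' p1' p2' p3' where C': "C' \<in> plane_curves 4" "k' \<noteq> 0" "p2' \<noteq> 0"
    "quartic k' (1, 0, 0, 0, 0, - 1) (p1', p2', p3') (0, 0, 1) \<in> C'"
    by (rule family1E[OF char3 assms(3)])
  obtain m11 m12 m13 m21 m22 m23 m31 m32 m33 s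
    where T: "T = projectivity (mat3 m11 m12 m13 m21 m22 m23 m31 m32 m33)" and s: "s \<noteq> 0"
      and raw: "0 * m11 + 0 * m21 + 1 * m31 = s * 0" "0 * m12 + 0 * m22 + 1 * m32 = s * 0" "0 * m13 + 0 * m23 + 1 * m33 = s * 1"
      and conic: "m11 ^ 2 - m21 * m31 \<noteq> 0" "m12 ^ 2 = m22 * m32" "m13 ^ 2 = m23 * m33"
        "2 * m11 * m12 = m21 * m32 + m22 * m31" "2 * m11 * m13 = m21 * m33 + m23 * m31"
        "m22 * m33 + m23 * m32 - 2 * m12 * m13 = m11 ^ 2 - m21 * m31"
    by (rule relates_conic_conicE[OF char3 assms(4) C'(1) C C'(2,3) disjI2[OF disjI2[OF one_neq_zero]] C'(4)])
  have line: "m33 \<noteq> 0" "m31 = 0" "m32 = 0" using raw s by simp_all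
  have m11: "m11 \<noteq> 0" and "m12 = 0" using conic(1,2) line by auto
  have m22: "m22 * m33 = m11 ^ 2" using conic(6) line \<open>m12 = 0\<close> by simp
  then have nz: "m22 \<noteq> 0" using m11 by auto
  have m33: "m33 = m11 ^ 2 / m22" using m22 nz by (simp add: field_simps)
  \<comment> \<open>The minus sign in the entry \<open>- (l1 / l2)\<close> originates here: it is
    the factor \<open>1/2 = -1\<close>.\<close>
  have "- (m11 * m13) = m21 * m33" using conic(5) line(2) by (simp add: two)
  then have "m11 * m13 = m11 * (- (m21 * m11 / m22))"
    by (simp add: m33 power2_eq_square minus_equation_iff[of "m11 * m13"] mult_ac)
  then have m13: "m13 = - (m21 * m11 / m22)" using mult_left_cancel[OF m11] by blast
  have "m23 * (m11 ^ 2 / m22) = (m21 * m11 / m22) ^ 2"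
    using conic(3) unfolding m13 m33 power2_minus by simp
  also have "\<dots> = m21 ^ 2 / m22 * (m11 ^ 2 / m22)"
    by (simp add: power2_eq_square mult_ac)
  finally have "m23 * (m11 ^ 2 / m22) = m21 ^ 2 / m22 * (m11 ^ 2 / m22)" .
  moreover have "m11 ^ 2 / m22 \<noteq> 0" using m11 nz by simp
  ultimately have m23: "m23 = m21 ^ 2 / m22" by (metis mult_right_cancel)
  have "T = projectivity (mat3 1 0 (- ((m21 / m11) / (m22 / m11))) (m21 / m11) (m22 / m11)
      ((m21 / m11) ^ 2 / (m22 / m11)) 0 0 (inverse (m22 / m11)))"
    unfolding T
    by (rule projectivity_mat3_scale[OF m11])
       (use m11 nz line in \<open>simp_all add: m13 m23 m33 \<open>m12 = 0\<close> field_simps power2_eq_square\<close>)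
  then show ?thesis using nz m11 by (intro exI[of _ "m21 / m11"] exI[of _ "m22 / m11"]) simp
qed

text \<open>The third row is already a multiple of \<open>z\<close>, and the other two rows define
  the lines \<open>x = 0\<close> and \<open>y = 0\<close> in one of the two orders.\<close>

lemma family2_automorphisms:
  fixes C C' :: "'k::field mpoly3 set"
  assumes char3: "(3::'k) = 0" and sc: "separably_closed_field TYPE('k)"
    and "C \<in> family2" "C' \<in> family2" "relates T C C'"
  shows "\<exists>l1 l2. l1 \<noteq> 0 \<and> l2 \<noteq> 0 \<and>
    (T = projectivity (mat3 l1 0 0 0 (inverse l1) 0 0 0 l2) \<or>
     T = projectivity (mat3 0 l1 0 (inverse l1) 0 0 0 0 l2))"
proof -
  have "(3::'k) = 2 + 1" by simp
  then have two: "(2::'k) \<noteq> 0" using char3 by (metis add_0 zero_neq_one)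
  obtain k p1 p2 p3 where C: "k \<noteq> 0" "quartic k (0, 0, 0, 1, 0, 0) (p1, p2, p3) (0, 0, 1) \<in> C"
    by (rule family2E[OF char3 assms(3)])
  obtain k' p1' p2' p3' where C': "C' \<in> plane_curves 4" "k' \<noteq> 0" "p3' \<noteq> 0"
    "quartic k' (0, 0, 0, 1, 0, 0) (p1', p2', p3') (0, 0, 1) \<in> C'"
    by (rule family2E[OF char3 assms(4)])
  from relates_line_pairE[OF char3 assms(5) C'(1) C C'(2-4)]
  obtain m11 m12 m13 m21 m22 m23 m33
    where T: "T = projectivity (mat3 m11 m12 m13 m21 m22 m23 0 0 m33)" and m33: "m33 \<noteq> 0"
      and q: "m11 * m21 = 0" "m12 * m22 = 0" "m13 * m23 = 0"
        "m11 * m22 + m12 * m21 \<noteq> 0" "m11 * m23 + m13 * m21 = 0" "m12 * m23 + m13 * m22 = 0" .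
  \<comment> \<open>The pullback of \<open>x y\<close> is \<open>r^2 x y\<close>; dividing the
    matrix by \<open>r\<close> makes the two nonzero entries of the upper block mutually
    inverse.\<close>
  obtain r where r: "r ^ 2 = m11 * m22 + m12 * m21"
    using sqrt_exists_if_separably_closed[OF sc two] by blast
  then have r0: "r \<noteq> 0" using q(4) by auto
  show ?thesis
  proof (cases "m11 = 0")
    case False
    then have z: "m21 = 0" "m23 = 0" using q(1,5) by auto
    then have "m22 \<noteq> 0" using q(4) by auto
    then have z': "m12 = 0" "m13 = 0" using q(2,6) z by auto
    have "T = projectivity (mat3 (m11 / r) 0 0 0 (inverse (m11 / r)) 0 0 0 (m33 / r))"
      unfolding T
      by (rule projectivity_mat3_scale[OF r0])
         (use r0 r False z z' in \<open>simp_all add: field_simps power2_eq_square\<close>)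
    then show ?thesis using False r0 m33 by (intro exI[of _ "m11 / r"] exI[of _ "m33 / r"]) simp
  next
    case True
    then have nz: "m12 \<noteq> 0" "m21 \<noteq> 0" using q(4) by auto
    then have z: "m13 = 0" "m22 = 0" using q(2,5) True by auto
    then have "m23 = 0" using q(6) nz by auto
    have "T = projectivity (mat3 0 (m12 / r) 0 (inverse (m12 / r)) 0 0 0 0 (m33 / r))"
      unfolding T
      by (rule projectivity_mat3_scale[OF r0])
         (use r0 r True nz z \<open>m23 = 0\<close> in \<open>simp_all add: field_simps power2_eq_square\<close>)
    then show ?thesis using nz r0 m33 by (intro exI[of _ "m12 / r"] exI[of _ "m33 / r"]) simp
  qed
qed

section \<open>Transformed equations\<close>

text \<open>Moving a scalar from the line into the cubic restores the line \<open>z\<close>; taking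
  cube roots of the result explains the fractional powers of \<open>l2\<close> in the second and
  third families.\<close>

lemma quartic_scale_line:
  "quartic k q (p1, p2, p3) (s * l1, s * l2, s * l3) = quartic k q (s * p1, s * p2, s * p3) (l1, l2, l3)"
  by (cases q) (simp add: linear_form_def diagonal_cubic_def mconst_mult algebra_simps)

text \<open>The normalised matrices fix \<open>x^2 - y z\<close> exactly and fix \<open>x\<close>,
  so substitution again yields an equation with leading coefficient 1 and no scalar has to be
  divided out.\<close>

lemma family0_equations:
  fixes C :: "'k::field mpoly3 set"
  assumes char3: "(3::'k) = 0"
    and ABG: "A \<in> cube_root_field" "B \<in> cube_root_field" "G \<in> cube_root_field"
    and C: "has_equation C ((var_x^2 - var_y * var_z)^2 + (linear_form A B G)^3 * var_x)"
    and l: "l \<noteq> 0"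
  shows "relates (projectivity (mat3 1 0 0 0 l 0 0 0 (inverse l))) C C' \<Longrightarrow>
      has_equation C' ((var_x^2 - var_y * var_z)^2
        + (linear_form A (to_ac l * B) (inverse (to_ac l) * G))^3 * var_x)"
    and "relates (projectivity (mat3 1 0 0 0 0 (inverse l) 0 l 0)) C C' \<Longrightarrow>
      has_equation C' ((var_x^2 - var_y * var_z)^2
        + (linear_form A (to_ac l * G) (inverse (to_ac l) * B))^3 * var_x)"
proof -
  note monic = monic_equation_eq_quartic[OF three_alg_closure[OF char3]]
  have "has_equation C (quartic (to_ac 1) (to_ac 1, to_ac 0, to_ac 0, to_ac 0, to_ac 0, to_ac (- 1))
      (A ^ 3, B ^ 3, G ^ 3) (to_ac 1, to_ac 0, to_ac 0))"
    using C unfolding monic by simp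
  from this ABG obtain p1 p2 p3 where p: "to_ac p1 = A ^ 3" "to_ac p2 = B ^ 3" "to_ac p3 = G ^ 3"
    and F: "quartic 1 (1, 0, 0, 0, 0, - 1) (p1, p2, p3) (1, 0, 0) \<in> C"
    by (rule has_equation_quarticE)
  note subst = linear_subst_quartic[OF char3 linear_subst_conic]
  show "has_equation C' ((var_x^2 - var_y * var_z)^2
        + (linear_form A (to_ac l * B) (inverse (to_ac l) * G))^3 * var_x)"
    if "relates (projectivity (mat3 1 0 0 0 l 0 0 0 (inverse l))) C C'"
  proof -
    have "quartic 1 (1, 0, 0, 0, 0, - 1) (p1, p2 * l ^ 3, p3 * inverse l ^ 3) (1, 0, 0) \<in> C'"
      using linear_subst_in_pullback[OF that F] l unfolding subst by (simp del: quartic.simps)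
    from has_equation_quarticI[OF this] show ?thesis
      unfolding monic by (simp add: p power_mult_distrib mult.commute del: quartic.simps)
  qed
  show "has_equation C' ((var_x^2 - var_y * var_z)^2
        + (linear_form A (to_ac l * G) (inverse (to_ac l) * B))^3 * var_x)"
    if "relates (projectivity (mat3 1 0 0 0 0 (inverse l) 0 l 0)) C C'"
  proof -
    have "quartic 1 (1, 0, 0, 0, 0, - 1) (p1, p3 * l ^ 3, p2 * inverse l ^ 3) (1, 0, 0) \<in> C'"
      using linear_subst_in_pullback[OF that F] l unfolding subst by (simp del: quartic.simps)
    from has_equation_quarticI[OF this] show ?thesis
      unfolding monic by (simp add: p power_mult_distrib mult.commute del: quartic.simps)
  qed
qed

lemma family1_equation:
  fixes C :: "'k::field mpoly3 set"
  assumes char3: "(3::'k) = 0"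
    and ABG: "A \<in> cube_root_field" "B \<in> cube_root_field" "G \<in> cube_root_field"
    and C: "has_equation C ((var_x^2 - var_y * var_z)^2 + (linear_form A B G)^3 * var_z)"
    and l2: "l2 \<noteq> 0"
    and R: "relates (projectivity (mat3 1 0 (- (l1 / l2)) l1 l2 (l1 ^ 2 / l2) 0 0 (inverse l2))) C C'"
  shows "has_equation C' ((var_x^2 - var_y * var_z)^2
    + (linear_form ((A + B * to_ac l1) / cbrt l2) ((cbrt l2)^2 * B)
        ((B * to_ac l1^2 - A * to_ac l1 + G) / (cbrt l2)^4))^3 * var_z)"
proof -
  note char3' = three_alg_closure[OF char3]
  note monic = monic_equation_eq_quartic[OF char3']
  have two: "(2::'k) = - 1" using char3 by (simp add: eq_neg_iff_add_eq_0)
  have "has_equation C (quartic (to_ac 1) (to_ac 1, to_ac 0, to_ac 0, to_ac 0, to_ac 0, to_ac (- 1))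
      (A ^ 3, B ^ 3, G ^ 3) (to_ac 0, to_ac 0, to_ac 1))"
    using C unfolding monic by simp
  from this ABG obtain p1 p2 p3 where p: "to_ac p1 = A ^ 3" "to_ac p2 = B ^ 3" "to_ac p3 = G ^ 3"
    and F: "quartic 1 (1, 0, 0, 0, 0, - 1) (p1, p2, p3) (0, 0, 1) \<in> C"
    by (rule has_equation_quarticE)
  \<comment> \<open>The \<open>x z\<close> coefficient of the transformed conic is
    \<open>-3 l1 / l2\<close>, which vanishes because of the characteristic.\<close>
  have "quartic 1 (1, 0, 0, 0, 0, - 1)
      (p1 + p2 * l1 ^ 3, p2 * l2 ^ 3, - (p1 * (l1 / l2) ^ 3) + p2 * (l1 ^ 2 / l2) ^ 3 + p3 * inverse l2 ^ 3)
      (inverse l2 * 0, inverse l2 * 0, inverse l2 * 1) \<in> C'"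
    using linear_subst_in_pullback[OF R F] l2
    unfolding linear_subst_quartic[OF char3 linear_subst_conic]
    by (simp add: two power2_eq_square divide_inverse mult_ac del: quartic.simps)
  from has_equation_quarticI[OF this[unfolded quartic_scale_line]]
  have transformed: "has_equation C' (quartic 1 (1, 0, 0, 0, 0, - 1)
    (to_ac (inverse l2 * (p1 + p2 * l1 ^ 3)), to_ac (inverse l2 * (p2 * l2 ^ 3)),
     to_ac (inverse l2 * (- (p1 * (l1 / l2) ^ 3) + p2 * (l1 ^ 2 / l2) ^ 3 + p3 * inverse l2 ^ 3)))
    (0, 0, 1))" by (simp del: quartic.simps to_ac_add to_ac_mult to_ac_inverse)
  have cb: "cbrt l2 ^ 3 = to_ac l2" by (rule cbrt_cube[OF char3])
  have cb': "(cbrt l2 ^ n) ^ 3 = to_ac l2 ^ n" for n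
    by (metis cb power_mult mult.commute)
  have cube_x: "((A + B * to_ac l1) / cbrt l2) ^ 3 = to_ac (inverse l2 * (p1 + p2 * l1 ^ 3))"
    unfolding power_divide cb cube_add_char3[OF char3'] power_mult_distrib
    by (simp add: p divide_inverse mult.commute)
  have cube_y: "(cbrt l2 ^ 2 * B) ^ 3 = to_ac (inverse l2 * (p2 * l2 ^ 3))"
    unfolding power_mult_distrib cb'
    using l2 by (simp add: p power2_eq_square power3_eq_cube)
  \<comment> \<open>The exponent 4 arises as 3 + 1: three factors from the cubed matrix entries and
    one from the line.\<close>
  have scaled:
    "inverse l2 * (- (p1 * (l1 / l2) ^ 3) + p2 * (l1 ^ 2 / l2) ^ 3 + p3 * inverse l2 ^ 3) =
      (p2 * (l1 ^ 2) ^ 3 - p1 * l1 ^ 3 + p3) / l2 ^ 4"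
  proof -
    have "inverse (l2 ^ 4) = inverse l2 * inverse l2 ^ 3"
      using l2 by (simp add: field_simps eval_nat_numeral)
    then show ?thesis
      unfolding divide_inverse power_mult_distrib
      by (simp only: distrib_left distrib_right diff_conv_add_uminus mult_minus_left mult_minus_right
          ac_simps)
  qed
  have cube_z: "((B * to_ac l1^2 - A * to_ac l1 + G) / (cbrt l2)^4) ^ 3 =
      to_ac (inverse l2 * (- (p1 * (l1 / l2) ^ 3) + p2 * (l1 ^ 2 / l2) ^ 3 + p3 * inverse l2 ^ 3))"
    unfolding scaled power_divide[of _ "_ ^ 4"] cube_add_char3[OF char3']
      cube_diff_char3[OF char3'] cb' power_mult_distrib by (simp add: p)
  show ?thesis unfolding monic cube_x cube_y cube_z by (fact transformed)
qed

lemma family2_equations: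
  fixes C :: "'k::field mpoly3 set"
  assumes char3: "(3::'k) = 0"
    and ABG: "A \<in> cube_root_field" "B \<in> cube_root_field" "G \<in> cube_root_field"
    and C: "has_equation C ((var_x * var_y)^2 + (linear_form A B G)^3 * var_z)"
    and l: "l1 \<noteq> 0" "l2 \<noteq> 0"
  shows "relates (projectivity (mat3 l1 0 0 0 (inverse l1) 0 0 0 l2)) C C' \<Longrightarrow>
      has_equation C' ((var_x * var_y)^2
        + (linear_form (cbrt l2 * to_ac l1 * A) (cbrt l2 * inverse (to_ac l1) * B)
            ((cbrt l2)^4 * G))^3 * var_z)"
    and "relates (projectivity (mat3 0 l1 0 (inverse l1) 0 0 0 0 l2)) C C' \<Longrightarrow>
      has_equation C' ((var_x * var_y)^2
        + (linear_form (cbrt l2 * inverse (to_ac l1) * B) (cbrt l2 * to_ac l1 * A)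
            ((cbrt l2)^4 * G))^3 * var_z)"
proof -
  note monic = monic_equation_eq_quartic[OF three_alg_closure[OF char3]]
  have "has_equation C (quartic (to_ac 1) (to_ac 0, to_ac 0, to_ac 0, to_ac 1, to_ac 0, to_ac 0)
      (A ^ 3, B ^ 3, G ^ 3) (to_ac 0, to_ac 0, to_ac 1))"
    using C unfolding monic by simp
  from this ABG obtain p1 p2 p3 where p: "to_ac p1 = A ^ 3" "to_ac p2 = B ^ 3" "to_ac p3 = G ^ 3"
    and F: "quartic 1 (0, 0, 0, 1, 0, 0) (p1, p2, p3) (0, 0, 1) \<in> C"
    by (rule has_equation_quarticE)
  have cb: "cbrt l2 ^ 3 = to_ac l2" by (rule cbrt_cube[OF char3])
  have cb': "(cbrt l2 ^ n) ^ 3 = to_ac l2 ^ n" for n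
    by (metis cb power_mult mult.commute)
  have cubes: "(cbrt l2 * to_ac l1 * A) ^ 3 = to_ac (l2 * (p1 * l1 ^ 3))"
    "(cbrt l2 * inverse (to_ac l1) * B) ^ 3 = to_ac (l2 * (p2 * inverse l1 ^ 3))"
    "((cbrt l2)^4 * G) ^ 3 = to_ac (l2 * (p3 * l2 ^ 3))"
    unfolding power_mult_distrib cb cb' by (simp_all add: p eval_nat_numeral)
  note subst = linear_subst_quartic[OF char3 linear_subst_line_pair]
  show "has_equation C' ((var_x * var_y)^2
        + (linear_form (cbrt l2 * to_ac l1 * A) (cbrt l2 * inverse (to_ac l1) * B)
            ((cbrt l2)^4 * G))^3 * var_z)"
    if "relates (projectivity (mat3 l1 0 0 0 (inverse l1) 0 0 0 l2)) C C'"
  proof -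
    have "quartic 1 (0, 0, 0, 1, 0, 0) (p1 * l1 ^ 3, p2 * inverse l1 ^ 3, p3 * l2 ^ 3)
        (l2 * 0, l2 * 0, l2 * 1) \<in> C'"
      using linear_subst_in_pullback[OF that F] l unfolding subst by (simp del: quartic.simps)
    from has_equation_quarticI[OF this[unfolded quartic_scale_line]] show ?thesis
      unfolding monic cubes by (simp del: quartic.simps)
  qed
  show "has_equation C' ((var_x * var_y)^2
        + (linear_form (cbrt l2 * inverse (to_ac l1) * B) (cbrt l2 * to_ac l1 * A)
            ((cbrt l2)^4 * G))^3 * var_z)"
    if "relates (projectivity (mat3 0 l1 0 (inverse l1) 0 0 0 0 l2)) C C'"
  proof -
    have "quartic 1 (0, 0, 0, 1, 0, 0) (p2 * inverse l1 ^ 3, p1 * l1 ^ 3, p3 * l2 ^ 3)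
        (l2 * 0, l2 * 0, l2 * 1) \<in> C'"
      using linear_subst_in_pullback[OF that F] l unfolding subst by (simp del: quartic.simps)
    from has_equation_quarticI[OF this[unfolded quartic_scale_line]] show ?thesis
      unfolding monic cubes by (simp del: quartic.simps)
  qed
qed

section \<open>Assembling the classification\<close>

lemma families_not_equivalent:
  fixes C C' :: "'k::field mpoly3 set"
  assumes char3: "(3::'k) = 0"
    and "i < 3" "j < 3" "i \<noteq> j"
    and "C \<in> [family0, family1, family2] ! i" "C' \<in> [family0, family1, family2] ! j"
  shows "\<not> plane_equivalent C C'"
proof -
  have conic: "\<exists>k p1 p2 p3 l. k \<noteq> 0 \<and> p2 \<noteq> 0 \<and> D \<in> plane_curves 4 \<and>
      quartic k (1, 0, 0, 0, 0, - 1) (p1, p2, p3) l \<in> D \<and> l = (if n = 0 then (1, 0, 0) else (0, 0, 1))"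
    if "D \<in> [family0, family1, family2] ! n" "n < 2" for D :: "'k mpoly3 set" and n :: nat
  proof -
    from that(2) consider "n = 0" | "n = 1" by linarith
    then show ?thesis
    proof cases
      case 1
      with that(1) have "D \<in> family0" by simp
      then obtain k p1 p2 p3 where "D \<in> plane_curves 4" "k \<noteq> 0" "p2 \<noteq> 0"
        "quartic k (1, 0, 0, 0, 0, - 1) (p1, p2, p3) (1, 0, 0) \<in> D"
        by (rule family0E[OF char3])
      then show ?thesis unfolding 1 if_P[OF refl] by blast
    next
      case 2
      with that(1) have "D \<in> family1" by simp
      then obtain k p1 p2 p3 where "D \<in> plane_curves 4" "k \<noteq> 0" "p2 \<noteq> 0"
        "quartic k (1, 0, 0, 0, 0, - 1) (p1, p2, p3) (0, 0, 1) \<in> D"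
        by (rule family1E[OF char3])
      then show ?thesis unfolding 2 if_not_P[OF one_neq_zero] by blast
    qed
  qed
  have pair: "\<exists>k p1 p2 p3. k \<noteq> 0 \<and> p3 \<noteq> 0 \<and> D \<in> plane_curves 4 \<and>
      quartic k (0, 0, 0, 1, 0, 0) (p1, p2, p3) (0, 0, 1) \<in> D"
    if "D \<in> [family0, family1, family2] ! n" "n = 2" for D :: "'k mpoly3 set" and n :: nat
  proof -
    from that have "D \<in> family2" by (simp add: numeral_2_eq_2)
    then show ?thesis by (rule family2E[OF char3]) blast
  qed
  \<comment> \<open>The relation is directed from \<open>C\<close> to \<open>C'\<close>, so the two
    orders of conic and line pair are excluded by different lemmas.\<close>
  have "\<not> relates T C C'" for T
  proof (cases "i = 2")
    case True
    with assms have "j < 2" by simp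
    from conic[OF assms(6) this] obtain k' p1' p2' p3' l' where C': "k' \<noteq> 0"
      "C' \<in> plane_curves 4" "quartic k' (1, 0, 0, 0, 0, - 1) (p1', p2', p3') l' \<in> C'" by blast
    from pair[OF assms(5) True] obtain k p1 p2 p3 where C: "k \<noteq> 0"
      "quartic k (0, 0, 0, 1, 0, 0) (p1, p2, p3) (0, 0, 1) \<in> C" by blast
    show ?thesis by (cases l', rule not_relates_line_pair_conic[OF char3 C'(2) C C'(1)], use C'(3) in simp)
  next
    case False
    with assms have "i < 2" by simp
    from conic[OF assms(5) this] obtain k p1 p2 p3 l where C: "k \<noteq> 0"
      "quartic k (1, 0, 0, 0, 0, - 1) (p1, p2, p3) l \<in> C"
      "l = (if i = 0 then (1, 0, 0) else (0, 0, 1))" by blast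
    show ?thesis
    proof (cases "j = 2")
      case True
      obtain k' p1' p2' p3' where C': "k' \<noteq> 0" "p3' \<noteq> 0" "C' \<in> plane_curves 4"
        "quartic k' (0, 0, 0, 1, 0, 0) (p1', p2', p3') (0, 0, 1) \<in> C'"
        using pair[OF assms(6) True] by blast
      have "l = (1, 0, 0) \<or> l = (0, 0, 1)" using C(3) by simp
      then show ?thesis by (rule not_relates_conic_line_pair[OF char3 C'(3) C(1,2) _ C'(1,2,4)])
    next
      case False
      with assms have "j < 2" by simp
      from conic[OF assms(6) this] obtain k' p1' p2' p3' l' where C': "k' \<noteq> 0" "p2' \<noteq> 0"
        "C' \<in> plane_curves 4" "quartic k' (1, 0, 0, 0, 0, - 1) (p1', p2', p3') l' \<in> C'"
        "l' = (if j = 0 then (1, 0, 0) else (0, 0, 1))" by blast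
      have "l = (1, 0, 0) \<and> l' = (0, 0, 1) \<or> l = (0, 0, 1) \<and> l' = (1, 0, 0)"
        using C(3) C'(5) \<open>i < 2\<close> \<open>j < 2\<close> assms(4) by auto
      then show ?thesis by (rule not_relates_conic_conic[OF char3 C'(3) C(1) C'(1,2) C(2) C'(4)])
    qed
  qed
  then show ?thesis unfolding plane_equivalent_def by blast
qed

text \<open>The sign is normalised to 1 here: negating a matrix with first entry \<open>-1\<close>
  gives the same projectivity with \<open>l\<close> replaced by \<open>- l\<close>.\<close>

lemma family0_equivalence:
  fixes C C' :: "'k::field mpoly3 set"
  assumes char3: "(3::'k) = 0" and "C \<in> family0" "C' \<in> family0"
    and ABG: "A \<in> cube_root_field" "B \<in> cube_root_field" "G \<in> cube_root_field"
    and C: "has_equation C ((var_x^2 - var_y * var_z)^2 + (linear_form A B G)^3 * var_x)"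
    and T: "relates T C C'"
  shows "\<exists>l. l \<noteq> 0 \<and>
      (has_equation C' ((var_x^2 - var_y * var_z)^2
          + (linear_form A (to_ac l * B) (inverse (to_ac l) * G))^3 * var_x) \<and>
       T = projectivity (mat3 1 0 0 0 l 0 0 0 (inverse l)) \<or>
       has_equation C' ((var_x^2 - var_y * var_z)^2
          + (linear_form A (to_ac l * G) (inverse (to_ac l) * B))^3 * var_x) \<and>
       T = projectivity (mat3 1 0 0 0 0 (inverse l) 0 l 0))"
  using family0_automorphisms[OF char3 assms(2,3) T] family0_equations[OF char3 ABG C] T by blast

lemma family1_equivalence:
  fixes C C' :: "'k::field mpoly3 set"
  assumes char3: "(3::'k) = 0" and "C \<in> family1" "C' \<in> family1"
    and ABG: "A \<in> cube_root_field" "B \<in> cube_root_field" "G \<in> cube_root_field"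
    and C: "has_equation C ((var_x^2 - var_y * var_z)^2 + (linear_form A B G)^3 * var_z)"
    and T: "relates T C C'"
  shows "\<exists>l1 l2. l2 \<noteq> 0 \<and>
      has_equation C' ((var_x^2 - var_y * var_z)^2
        + (linear_form ((A + B * to_ac l1) / cbrt l2) ((cbrt l2)^2 * B)
            ((B * to_ac l1^2 - A * to_ac l1 + G) / (cbrt l2)^4))^3 * var_z) \<and>
      T = projectivity (mat3 1 0 (- (l1 / l2)) l1 l2 (l1 ^ 2 / l2) 0 0 (inverse l2))"
  using family1_automorphisms[OF char3 assms(2,3) T] family1_equation[OF char3 ABG C] T by blast

lemma family2_equivalence:
  fixes C C' :: "'k::field mpoly3 set"
  assumes char3: "(3::'k) = 0" and sc: "separably_closed_field TYPE('k)"
    and "C \<in> family2" "C' \<in> family2"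
    and ABG: "A \<in> cube_root_field" "B \<in> cube_root_field" "G \<in> cube_root_field"
    and C: "has_equation C ((var_x * var_y)^2 + (linear_form A B G)^3 * var_z)"
    and T: "relates T C C'"
  shows "\<exists>l1 l2. l1 \<noteq> 0 \<and> l2 \<noteq> 0 \<and>
      (has_equation C' ((var_x * var_y)^2
          + (linear_form (cbrt l2 * to_ac l1 * A) (cbrt l2 * inverse (to_ac l1) * B)
              ((cbrt l2)^4 * G))^3 * var_z) \<and>
       T = projectivity (mat3 l1 0 0 0 (inverse l1) 0 0 0 l2) \<or>
       has_equation C' ((var_x * var_y)^2
          + (linear_form (cbrt l2 * inverse (to_ac l1) * B) (cbrt l2 * to_ac l1 * A)
              ((cbrt l2)^4 * G))^3 * var_z) \<and>
       T = projectivity (mat3 0 l1 0 (inverse l1) 0 0 0 0 l2))"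
  using family2_automorphisms[OF char3 sc assms(3,4) T] family2_equations[OF char3 ABG C] T by blast

theorem theorem6p13:
  assumes char3: "CHAR('k::field) = 3"
    and nonperfect: "\<not> perfect_field TYPE('k)"
    and sep_closed: "separably_closed_field TYPE('k)"
  shows "(\<forall>i<3. \<forall>j<3. i \<noteq> j \<longrightarrow>
      (\<forall>C \<in> [family0, family1, family2] ! i. \<forall>C' \<in> [family0, family1, family2] ! j.
         \<not> plane_equivalent (C :: 'k mpoly3 set) C')) \<and>
    (\<forall>C\<in>family0. \<forall>C'\<in>family0. \<forall>A\<in>cube_root_field. \<forall>B\<in>cube_root_field. \<forall>G\<in>cube_root_field.
      plane_equivalent (C :: 'k mpoly3 set) C' \<and>
      has_equation C ((var_x^2 - var_y * var_z)^2 + (linear_form A B G)^3 * var_x) \<longrightarrow>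
      (\<exists>\<beta>\<in>{1, -1}. \<exists>l. l \<noteq> 0 \<and>
        (has_equation C' ((var_x^2 - var_y * var_z)^2
            + (linear_form A (to_ac \<beta> * to_ac l * B) (to_ac \<beta> * inverse (to_ac l) * G))^3 * var_x)
       \<or> has_equation C' ((var_x^2 - var_y * var_z)^2
            + (linear_form A (to_ac l * to_ac \<beta> * G) (inverse (to_ac l) * to_ac \<beta> * B))^3 * var_x))) \<and>
      (\<forall>T. relates T C C' \<longrightarrow>
        (\<exists>\<beta>\<in>{1, -1}. \<exists>l. l \<noteq> 0 \<and>
          (has_equation C' ((var_x^2 - var_y * var_z)^2
              + (linear_form A (to_ac \<beta> * to_ac l * B) (to_ac \<beta> * inverse (to_ac l) * G))^3 * var_x) \<and>
           T = projectivity (vector [vector [\<beta>, 0, 0],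
                                     vector [0, l, 0],
                                     vector [0, 0, inverse l]])
         \<or> has_equation C' ((var_x^2 - var_y * var_z)^2
              + (linear_form A (to_ac l * to_ac \<beta> * G) (inverse (to_ac l) * to_ac \<beta> * B))^3 * var_x) \<and>
           T = projectivity (vector [vector [\<beta>, 0, 0],
                                     vector [0, 0, inverse l],
                                     vector [0, l, 0]]))))) \<and>
    (\<forall>C\<in>family1. \<forall>C'\<in>family1. \<forall>A\<in>cube_root_field. \<forall>B\<in>cube_root_field. \<forall>G\<in>cube_root_field.
      plane_equivalent (C :: 'k mpoly3 set) C' \<and>
      has_equation C ((var_x^2 - var_y * var_z)^2 + (linear_form A B G)^3 * var_z) \<longrightarrow>
      (\<exists>\<beta>\<in>{1, -1}. \<exists>l1 l2. l2 \<noteq> 0 \<and>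
        has_equation C' ((var_x^2 - var_y * var_z)^2
          + (linear_form ((to_ac \<beta> * A + B * to_ac l1) / cbrt l2)
                         ((cbrt l2)^2 * B)
                         ((B * to_ac l1^2 - to_ac \<beta> * A * to_ac l1 + G) / (cbrt l2)^4))^3 * var_z)) \<and>
      (\<forall>T. relates T C C' \<longrightarrow>
        (\<exists>\<beta>\<in>{1, -1}. \<exists>l1 l2. l2 \<noteq> 0 \<and>
          has_equation C' ((var_x^2 - var_y * var_z)^2
            + (linear_form ((to_ac \<beta> * A + B * to_ac l1) / cbrt l2)
                           ((cbrt l2)^2 * B)
                           ((B * to_ac l1^2 - to_ac \<beta> * A * to_ac l1 + G) / (cbrt l2)^4))^3 * var_z) \<and>
          T = projectivity (vector [vector [\<beta>, 0, - \<beta> * (l1 / l2)],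
                                    vector [l1, l2, l1^2 / l2],
                                    vector [0, 0, inverse l2]])))) \<and>
    (\<forall>C\<in>family2. \<forall>C'\<in>family2. \<forall>A\<in>cube_root_field. \<forall>B\<in>cube_root_field. \<forall>G\<in>cube_root_field.
      plane_equivalent (C :: 'k mpoly3 set) C' \<and>
      has_equation C ((var_x * var_y)^2 + (linear_form A B G)^3 * var_z) \<longrightarrow>
      (\<exists>l1 l2. l1 \<noteq> 0 \<and> l2 \<noteq> 0 \<and>
        (has_equation C' ((var_x * var_y)^2
            + (linear_form (cbrt l2 * to_ac l1 * A) (cbrt l2 * inverse (to_ac l1) * B)
                           ((cbrt l2)^4 * G))^3 * var_z)
       \<or> has_equation C' ((var_x * var_y)^2
            + (linear_form (cbrt l2 * inverse (to_ac l1) * B) (cbrt l2 * to_ac l1 * A)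
                           ((cbrt l2)^4 * G))^3 * var_z))) \<and>
      (\<forall>T. relates T C C' \<longrightarrow>
        (\<exists>l1 l2. l1 \<noteq> 0 \<and> l2 \<noteq> 0 \<and>
          (has_equation C' ((var_x * var_y)^2
              + (linear_form (cbrt l2 * to_ac l1 * A) (cbrt l2 * inverse (to_ac l1) * B)
                             ((cbrt l2)^4 * G))^3 * var_z) \<and>
           T = projectivity (vector [vector [l1, 0, 0],
                                     vector [0, inverse l1, 0],
                                     vector [0, 0, l2]])
         \<or> has_equation C' ((var_x * var_y)^2
              + (linear_form (cbrt l2 * inverse (to_ac l1) * B) (cbrt l2 * to_ac l1 * A)
                             ((cbrt l2)^4 * G))^3 * var_z) \<and>
           T = projectivity (vector [vector [0, l1, 0],
                                     vector [inverse l1, 0, 0],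
                                     vector [0, 0, l2]])))))"
proof -
  have three: "(3::'k) = 0" using of_nat_CHAR[where 'a = 'k] char3 by simp
  show ?thesis
  proof (intro conjI allI impI ballI, goal_cases)
    case (1 i j C C')
    then show ?case using families_not_equivalent[OF three] by blast
  next
    case (2 C C' A B G)
    then obtain T where "relates T C C'" by (auto simp: plane_equivalent_def)
    with 2 have "\<exists>l. l \<noteq> 0 \<and>
        (has_equation C' ((var_x^2 - var_y * var_z)^2
            + (linear_form A (to_ac l * B) (inverse (to_ac l) * G))^3 * var_x) \<or>
         has_equation C' ((var_x^2 - var_y * var_z)^2
            + (linear_form A (to_ac l * G) (inverse (to_ac l) * B))^3 * var_x))"
      using family0_equivalence[OF three, of C C' A B G T] by blast
    \<comment> \<open>The witness 1 for the sign reflects the normalisation of the first matrix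
      entry to 1; the sign -1 is absorbed by negating \<open>l\<close>, and in the second family by
      negating both \<open>l1\<close> and \<open>l2\<close>.\<close>
    then show ?case by (intro bexI[of _ 1]) simp_all
  next
    case (3 C C' A B G T)
    then show ?case
      using family0_equivalence[OF three, of C C' A B G T] by (intro bexI[of _ 1]) simp_all
  next
    case (4 C C' A B G)
    then obtain T where "relates T C C'" by (auto simp: plane_equivalent_def)
    with 4 have "\<exists>l1 l2. l2 \<noteq> 0 \<and>
        has_equation C' ((var_x^2 - var_y * var_z)^2
          + (linear_form ((A + B * to_ac l1) / cbrt l2) ((cbrt l2)^2 * B)
              ((B * to_ac l1^2 - A * to_ac l1 + G) / (cbrt l2)^4))^3 * var_z)"
      using family1_equivalence[OF three, of C C' A B G T] by blast
    then show ?case by (intro bexI[of _ 1]) simp_all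
  next
    case (5 C C' A B G T)
    then show ?case
      using family1_equivalence[OF three, of C C' A B G T] by (intro bexI[of _ 1]) simp_all
  next
    case (6 C C' A B G)
    then obtain T where "relates T C C'" by (auto simp: plane_equivalent_def)
    with 6 show ?case
      using family2_equivalence[OF three sep_closed, of C C' A B G T] by blast
  next
    case (7 C C' A B G T)
    then show ?case
      using family2_equivalence[OF three sep_closed, of C C' A B G T] by blast
  qed
qed

end
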